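(* Let $r\ge1$ be an integer and let $m$ be an $L^{2r}(\mathbb{R})$ multiplier supported in $(-1/2,1/2]$. There is a constant $C_r$ such that the following holds. Let $(q_1,\dots,q_r)$ be a tuple of distinct positive integers that are pairwise relatively prime. Then as long as $0<\varepsilon<r^{-1}\max\{q_1,\dots,q_r\}^{-2r}$, for all $f\in\ell^{2r}(\mathbb{Z})$, $$\Big\||F_{q_1}|^{1/r}\cdots|F_{q_r}|^{1/r}\Big\|_{\ell^{2r}(\mathbb{Z})}\le C_r\Big\|(S_{q_1}(f))^{1/r}\cdots(S_{q_r}(f))^{1/r}\Big\|_{\ell^{2r}(\mathbb{Z})},$$ where $$F_q=\sum_{a/q\in\mathcal{R}(q)}f_{a/q},\qquad S_q(f)=\Big(\sum_{a/q\in\mathcal{R}(q)}|f_{a/q}|^2\Big)^{1/2},$$ and $C_r$ is independent of $q_1,\dots,q_r$, $\varepsilon$ and $f$.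
   Context: For $f\in\ell^1(\mathbb{Z})$ put $\widehat f(\xi)=\sum_{n\in\mathbb{Z}}f(n)e^{-2\pi i n\xi}$, a 1-periodic function. Let $\mathscr{F}$ be the Euclidean Fourier transform on $\mathbb{R}$. A bounded measurable function $m:\mathbb{R}\to\mathbb{C}$ is an $L^p(\mathbb{R})$ multiplier if $Tf=\mathscr{F}^{-1}(m\cdot\mathscr{F}f)$ is bounded on $L^p(\mathbb{R})$. For a positive integer $q$, $\mathcal{R}(q)=\{a/q: 1\le a\le q,\ \gcd(a,q)=1\}$. Given $m$ and $\varepsilon$, the function $f_{a/q}$ on $\mathbb{Z}$ is defined for $f\in\ell^1(\mathbb{Z})$ by $$\widehat{f_{a/q}}(\xi)=\sum_{\ell\in\mathbb{Z}}m\big(\varepsilon^{-1}(\xi-\ell-a/q)\big)\,\widehat f(\xi);$$ for $f\in\ell^{2r}(\mathbb{Z})$ the operators $f\mapsto f_{a/q}$ are understood as the bounded extensions by density. *)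

theory Defs
  imports "HOL-Analysis.Analysis"
begin

text \<open>The $L^p(M)$ norm, with value \<open>\<infinity>\<close> off $L^p$: the Bochner integral of a non-integrable
  function is $0$, so integrability has to be tested explicitly.\<close>
definition Lp_norm :: "'a measure \<Rightarrow> real \<Rightarrow> ('a \<Rightarrow> 'b::real_normed_vector) \<Rightarrow> ennreal" where
  "Lp_norm M p f =
     (if integrable M (\<lambda>x. norm (f x) powr p)
      then ennreal ((\<integral>x. norm (f x) powr p \<partial>M) powr (1 / p)) else \<infinity>)"

abbreviation lp_norm :: "real \<Rightarrow> (int \<Rightarrow> 'b::real_normed_vector) \<Rightarrow> ennreal" where
  "lp_norm \<equiv> Lp_norm (count_space UNIV)"

definition fourier :: "(real \<Rightarrow> complex) \<Rightarrow> real \<Rightarrow> complex" where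
  "fourier f \<xi> = (\<integral>x. f x * cis (- 2 * pi * x * \<xi>) \<partial>lebesgue)"

definition inv_fourier :: "(real \<Rightarrow> complex) \<Rightarrow> real \<Rightarrow> complex" where
  "inv_fourier g x = (\<integral>\<xi>. g \<xi> * cis (2 * pi * x * \<xi>) \<partial>lebesgue)"

definition multiplier_op :: "(real \<Rightarrow> complex) \<Rightarrow> (real \<Rightarrow> complex) \<Rightarrow> real \<Rightarrow> complex" where
  "multiplier_op m f = inv_fourier (\<lambda>\<xi>. m \<xi> * fourier f \<xi>)"

text \<open>Boundedness on $L^p(\mathbb{R})$ is the a priori bound on the functions \<open>f\<close> for which both
  integrals in $\mathscr{F}^{-1}(m \cdot \mathscr{F} f)$ converge absolutely for every bounded
  \<open>m\<close>. These contain the Schwartz functions, hence are dense in $L^p$ for finite \<open>p\<close>, and are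
  contained in $L^2 \cap L^p$; the bound on Schwartz functions implies the bound on all of them.\<close>
definition Lp_multiplier :: "real \<Rightarrow> (real \<Rightarrow> complex) \<Rightarrow> bool" where
  "Lp_multiplier p m \<longleftrightarrow>
     m \<in> borel_measurable lebesgue \<and> bounded (range m) \<and>
     (\<exists>A::real. \<forall>f. integrable lebesgue f \<and> integrable lebesgue (fourier f) \<and>
        Lp_norm lebesgue p f < \<infinity> \<longrightarrow>
        Lp_norm lebesgue p (multiplier_op m f) \<le> ennreal A * Lp_norm lebesgue p f)"

definition fourier_series :: "(int \<Rightarrow> complex) \<Rightarrow> real \<Rightarrow> complex" where
  "fourier_series f \<xi> = (\<Sum>\<^sub>\<infinity>n. f n * cis (- 2 * pi * of_int n * \<xi>))"

text \<open>For $f \in \ell^1$, the function on $\mathbb{Z}$ whose Fourier transform is the 1-periodic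
  function $\sum_\ell m(\varepsilon^{-1}(\xi - \ell - \theta)) \hat f(\xi)$, that is, the sequence
  of Fourier coefficients of the latter. It lies in $\ell^2$ but in general not in $\ell^1$, so
  it cannot be specified by its (absolutely convergent) \<^const>\<open>fourier_series\<close>.\<close>
definition freq_piece_l1 ::
    "(real \<Rightarrow> complex) \<Rightarrow> real \<Rightarrow> real \<Rightarrow> (int \<Rightarrow> complex) \<Rightarrow> int \<Rightarrow> complex" where
  "freq_piece_l1 m \<epsilon> \<theta> f n =
     (LINT \<xi>:{0..1}|lebesgue.
        (\<Sum>\<^sub>\<infinity>l::int. m (inverse \<epsilon> * (\<xi> - of_int l - \<theta>)) * fourier_series f \<xi>)
          * cis (2 * pi * of_int n * \<xi>))"

text \<open>Extension by density of an operator from $\ell^1$ to $\ell^p$ (\<open>p\<close> finite): the image of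
  \<open>f\<close> is the common $\ell^p$ limit of \<open>T (\<phi> k)\<close> over all sequences \<open>\<phi>\<close> in
  $\ell^1$ that converge to \<open>f\<close> in $\ell^p$.\<close>
definition lp_extension ::
    "real \<Rightarrow> ((int \<Rightarrow> complex) \<Rightarrow> int \<Rightarrow> complex) \<Rightarrow> (int \<Rightarrow> complex) \<Rightarrow> int \<Rightarrow> complex" where
  "lp_extension p T f =
     (THE g. lp_norm p g < \<infinity> \<and>
        (\<forall>\<phi>::nat \<Rightarrow> int \<Rightarrow> complex.
           (\<forall>k. lp_norm 1 (\<phi> k) < \<infinity>) \<and> (\<lambda>k. lp_norm p (\<lambda>n. \<phi> k n - f n)) \<longlonglongrightarrow> 0 \<longrightarrow>
           (\<lambda>k. lp_norm p (\<lambda>n. T (\<phi> k) n - g n)) \<longlonglongrightarrow> 0))"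

definition freq_piece ::
    "real \<Rightarrow> (real \<Rightarrow> complex) \<Rightarrow> real \<Rightarrow> real \<Rightarrow> (int \<Rightarrow> complex) \<Rightarrow> int \<Rightarrow> complex" where
  "freq_piece p m \<epsilon> \<theta> = lp_extension p (freq_piece_l1 m \<epsilon> \<theta>)"

definition reduced_fracs :: "nat \<Rightarrow> real set" where
  "reduced_fracs q = {real a / real q | a. 1 \<le> a \<and> a \<le> q \<and> coprime a q}"

definition freq_sum ::
    "real \<Rightarrow> (real \<Rightarrow> complex) \<Rightarrow> real \<Rightarrow> nat \<Rightarrow> (int \<Rightarrow> complex) \<Rightarrow> int \<Rightarrow> complex" where
  "freq_sum p m \<epsilon> q f n = (\<Sum>\<theta>\<in>reduced_fracs q. freq_piece p m \<epsilon> \<theta> f n)"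

definition freq_square ::
    "real \<Rightarrow> (real \<Rightarrow> complex) \<Rightarrow> real \<Rightarrow> nat \<Rightarrow> (int \<Rightarrow> complex) \<Rightarrow> int \<Rightarrow> real" where
  "freq_square p m \<epsilon> q f n =
     sqrt (\<Sum>\<theta>\<in>reduced_fracs q. (norm (freq_piece p m \<epsilon> \<theta> f n))\<^sup>2)"

end

theory Submission
  imports Defs "HOL-Probability.Sinc_Integral"
begin

text \<open>The inequality holds with constant 1, as an equality. Expanding
  $\prod_i |F_{q_i}|^2$ gives terms $\prod_i f_{a_i/q_i} \overline{f_{b_i/q_i}}$, whose spectrum lies
  within $r\varepsilon$ of $\sum_i (a_i - b_i)/q_i$. By coprimality this number is an integer only if
  $a_i = b_i$ for all $i$, and otherwise its distance to the integers is at least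
  $1/\prod_i q_i > r\varepsilon$, so that the term sums to zero over $\mathbb{Z}$; the remaining terms
  make up $\prod_i S_{q_i}^2$. The operators $f \mapsto f_{a/q}$ are bounded on $\ell^{2r}$ by
  transference: a sequence is interpolated on $\varepsilon\mathbb{Z}$ by a band-limited kernel, and
  the image under the multiplier is sampled there again. Hence they extend by density, and the
  orthogonality passes to the limit from finitely supported sequences.\<close>

section \<open>The de la Vallee Poussin kernel\<close>

text \<open>The kernel has to meet two competing demands. Its Fourier transform must equal 1 on the
  support of \<open>m\<close>, so that inserting it before or after the multiplier changes nothing;
  and it must decay like \<open>1 / x\<^sup>2\<close>, so that it is integrable and its sums over
  translates of \<epsilon>Z are bounded. The inverse transform of a sharp cutoff decays too slowly;
  that of a trapezoid meets both demands. The transference bound depends on \<epsilon>. This is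
  harmless: it only serves to give the extension by density a meaning, and never enters the
  inequality. The widths add up because each of the 2r factors of a term occupies an interval of
  half-width \<epsilon>/2. The Fourier integral of a piece is available only for summable f, so the
  spectral argument does not apply to a general f directly. What passes to the limit is the
  vanishing of the sum over Z of a full product of 2r pieces, and 2r is an exponent for which such
  products are summable.\<close>

lemma integrable_inverse_one_plus_square:
  "integrable lborel (\<lambda>x::real. 1 / (1 + x\<^sup>2))"
  using integrable_inverse_1_plus_square
  by (simp add: set_integrable_def inverse_eq_divide)

lemma one_minus_cos_le: "1 - cos x \<le> x\<^sup>2 / 2" for x :: real
proof -
  have "1 - cos x = 2 * (sin (x / 2))\<^sup>2"
    using cos_double_sin[of "x / 2"] by simp
  also have "(sin (x / 2))\<^sup>2 \<le> (x / 2)\<^sup>2"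
    using abs_sin_x_le_abs_x[of "x / 2"] by (rule abs_le_square_iff[THEN iffD1])
  finally show ?thesis by (simp add: power_divide)
qed

text \<open>The quadratic bound on \<open>1 - cos\<close> controls the quotient near the origin, the
  bound by 2 controls its decay. Adding the two gives one estimate for all \<open>x\<close>; at 0
  the quotient is 0 by convention.\<close>

lemma one_minus_cos_div_le:
  "\<bar>(1 - cos (a * x)) / x\<^sup>2\<bar> \<le> (4 + a\<^sup>2) / (1 + x\<^sup>2)" for a x :: real
proof (cases "x = 0")
  case False
  have nonneg: "0 \<le> 1 - cos (a * x)"
    by simp
  have "(1 - cos (a * x)) * (1 + x\<^sup>2) \<le> (4 + a\<^sup>2) * x\<^sup>2"
  proof -
    have "1 - cos (a * x) \<le> (a * x)\<^sup>2 / 2"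
      by (rule one_minus_cos_le)
    moreover have "1 - cos (a * x) \<le> 2"
      using cos_ge_minus_one[of "a * x"] by simp
    hence "(1 - cos (a * x)) * x\<^sup>2 \<le> 2 * x\<^sup>2"
      by (intro mult_right_mono) auto
    moreover have "(a * x)\<^sup>2 / 2 + 2 * x\<^sup>2 \<le> (4 + a\<^sup>2) * x\<^sup>2"
      by (simp add: algebra_simps power_mult_distrib)
    moreover have "(1 - cos (a * x)) * (1 + x\<^sup>2) = (1 - cos (a * x)) + (1 - cos (a * x)) * x\<^sup>2"
      by (simp add: ring_distribs)
    ultimately show ?thesis by linarith
  qed
  moreover have "\<bar>(1 - cos (a * x)) / x\<^sup>2\<bar> = (1 - cos (a * x)) / x\<^sup>2"
    using nonneg by simp
  ultimately show ?thesis
    using False by (simp add: divide_simps add_nonneg_eq_0_iff add_pos_nonneg)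
qed simp

lemma integrable_one_minus_cos_div:
  "integrable lborel (\<lambda>x::real. (1 - cos (a * x)) / x\<^sup>2)"
proof (rule Bochner_Integration.integrable_bound)
  show "integrable lborel (\<lambda>x::real. (4 + a\<^sup>2) * (1 / (1 + x\<^sup>2)))"
    by (intro integrable_mult_right integrable_inverse_one_plus_square)
  show "AE x in lborel. norm ((1 - cos (a * x)) / x\<^sup>2) \<le> norm ((4 + a\<^sup>2) * (1 / (1 + x\<^sup>2)))"
    using one_minus_cos_div_le[of a] by (intro AE_I2) (simp add: abs_mult add_nonneg_nonneg)
qed simp

text \<open>The value is $\pi$, but as a normalising constant it only has to be positive.\<close>
definition kappa :: real where
  "kappa = (\<integral>x. (1 - cos x) / x\<^sup>2 \<partial>lborel)"

text \<open>By rescaling \<open>x\<close>. This exhibits the absolute value as a cosine integral, so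
  that a piecewise linear function becomes the transform of an explicit kernel without evaluating
  \<open>kappa\<close>.\<close>

lemma integral_one_minus_cos_div:
  "(\<integral>x. (1 - cos (a * x)) / x\<^sup>2 \<partial>lborel) = \<bar>a\<bar> * kappa"
proof (cases "a = 0")
  case False
  have "kappa = \<bar>a\<bar> *\<^sub>R (\<integral>x. (1 - cos (0 + a * x)) / (0 + a * x)\<^sup>2 \<partial>lborel)"
    unfolding kappa_def by (rule lborel_integral_real_affine[OF False])
  also have "(\<integral>x. (1 - cos (0 + a * x)) / (0 + a * x)\<^sup>2 \<partial>lborel)
      = (\<integral>x. (1 / a\<^sup>2) * ((1 - cos (a * x)) / x\<^sup>2) \<partial>lborel)"
    by (simp add: power_mult_distrib)
  also have "\<dots> = (1 / a\<^sup>2) * (\<integral>x. (1 - cos (a * x)) / x\<^sup>2 \<partial>lborel)"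
    by (rule integral_mult_right_zero)
  finally show ?thesis
    using False by (cases "a > 0") (simp_all add: field_simps power2_eq_square)
qed simp

text \<open>The integrand is nonnegative, so a vanishing integral would force
  \<open>cos x = 1\<close> for almost every \<open>x\<close>, which fails on all of
  \<open>{1..2}\<close>.\<close>

lemma kappa_pos: "0 < kappa"
proof -
  have "0 \<le> kappa"
    unfolding kappa_def by (rule integral_nonneg_AE) simp
  moreover have "kappa \<noteq> 0"
  proof
    assume "kappa = 0"
    have int: "integrable lborel (\<lambda>x::real. (1 - cos x) / x\<^sup>2)"
      using integrable_one_minus_cos_div[of 1] by simp
    have nonneg: "AE x::real in lborel. 0 \<le> (1 - cos x) / x\<^sup>2"
      by simp
    have "AE x::real in lborel. (1 - cos x) / x\<^sup>2 = 0"
      using integral_nonneg_eq_0_iff_AE[OF int nonneg] \<open>kappa = 0\<close>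
      unfolding kappa_def by blast
    then have "AE x::real in lborel. x \<notin> {1..2}"
    proof eventually_elim
      case (elim x)
      show ?case
      proof
        assume x: "x \<in> {1..2}"
        with elim have "cos x = 1" by auto
        moreover have "cos x < cos 0"
          using x pi_gt3 by (intro cos_monotone_0_pi) auto
        ultimately show False by simp
      qed
    qed
    hence "emeasure lborel {1..2::real} = 0"
      by (subst (asm) AE_iff_measurable[where N = "{1..2}"]) auto
    thus False by simp
  qed
  ultimately show ?thesis by simp
qed

text \<open>At \<open>0\<close> this takes the junk value \<open>0\<close> instead of the limit of the kernel.\<close>
definition vp_kernel :: "real \<Rightarrow> real" where
  "vp_kernel x = (cos (2 * pi * x) - cos (4 * pi * x)) / x\<^sup>2 / (2 * pi * kappa)"

lemma vp_kernel_minus [simp]: "vp_kernel (- x) = vp_kernel x"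
  by (simp add: vp_kernel_def)

lemma borel_measurable_vp_kernel [measurable]: "vp_kernel \<in> borel_measurable borel"
  unfolding vp_kernel_def by measurable

lemma vp_kernel_bound: "\<exists>C>0. \<forall>x. \<bar>vp_kernel x\<bar> \<le> C / (1 + x\<^sup>2)"
proof -
  let ?C = "((4 + (2 * pi)\<^sup>2) + (4 + (4 * pi)\<^sup>2)) / (2 * pi * kappa)"
  have "\<bar>vp_kernel x\<bar> \<le> ?C / (1 + x\<^sup>2)" for x
  proof -
    have "(cos (2 * pi * x) - cos (4 * pi * x)) / x\<^sup>2
        = (1 - cos (4 * pi * x)) / x\<^sup>2 - (1 - cos (2 * pi * x)) / x\<^sup>2"
      by (simp add: diff_divide_distrib)
    also have "\<bar>\<dots>\<bar> \<le> (4 + (4 * pi)\<^sup>2) / (1 + x\<^sup>2) + (4 + (2 * pi)\<^sup>2) / (1 + x\<^sup>2)"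
      using one_minus_cos_div_le[of "4 * pi" x] one_minus_cos_div_le[of "2 * pi" x]
      by linarith
    finally have *: "\<bar>(cos (2 * pi * x) - cos (4 * pi * x)) / x\<^sup>2\<bar>
        \<le> ((4 + (2 * pi)\<^sup>2) + (4 + (4 * pi)\<^sup>2)) / (1 + x\<^sup>2)"
      by (simp add: add_divide_distrib)
    have "\<bar>vp_kernel x\<bar> = \<bar>(cos (2 * pi * x) - cos (4 * pi * x)) / x\<^sup>2\<bar> / (2 * pi * kappa)"
      using kappa_pos by (simp add: vp_kernel_def abs_mult)
    also have "\<dots> \<le> ((4 + (2 * pi)\<^sup>2) + (4 + (4 * pi)\<^sup>2)) / (1 + x\<^sup>2) / (2 * pi * kappa)"
      using kappa_pos by (intro divide_right_mono *) auto
    finally show ?thesis by (simp add: field_simps)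
  qed
  moreover have "?C > 0"
    using kappa_pos by (intro divide_pos_pos add_pos_nonneg) auto
  ultimately show ?thesis by blast
qed

lemma integrable_vp_kernel: "integrable lborel vp_kernel"
proof -
  obtain C where C: "C > 0" "\<And>x. \<bar>vp_kernel x\<bar> \<le> C / (1 + x\<^sup>2)"
    using vp_kernel_bound by blast
  show ?thesis
  proof (rule Bochner_Integration.integrable_bound)
    show "integrable lborel (\<lambda>x::real. C * (1 / (1 + x\<^sup>2)))"
      by (intro integrable_mult_right integrable_inverse_one_plus_square)
    show "AE x in lborel. norm (vp_kernel x) \<le> norm (C * (1 / (1 + x\<^sup>2)))"
      using C by (intro AE_I2) (simp add: abs_mult add_nonneg_nonneg)
  qed simp
qed

lemma integral_odd_eq_0:
  fixes f :: "real \<Rightarrow> real"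
  assumes "\<And>x. f (- x) = - f x"
  shows "(\<integral>x. f x \<partial>lborel) = 0"
proof -
  have "(\<integral>x. f x \<partial>lborel) = (\<integral>x. f (0 + (-1) * x) \<partial>lborel)"
    by (subst lborel_integral_real_affine[of "-1" f 0]) simp_all
  thus ?thesis using assms by simp
qed

text \<open>The function that is 1 on \<open>{-1..1}\<close>, 0 off \<open>{-2..2}\<close> and
  affine in between. It is written with absolute values because each of them is a value of
  \<open>integral_one_minus_cos_div\<close>.\<close>

definition trapezoid :: "real \<Rightarrow> real" where
  "trapezoid \<eta> = (\<bar>2 + \<eta>\<bar> + \<bar>2 - \<eta>\<bar> - \<bar>1 + \<eta>\<bar> - \<bar>1 - \<eta>\<bar>) / 2"

text \<open>Product-to-sum formulas turn the integrand into four cosine quotients. Two come with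
  each sign, so a constant 1 can be inserted in each of them, which makes every quotient integrable
  by itself.\<close>

lemma integral_vp_kernel_cos:
  "(\<integral>x. vp_kernel x * cos (2 * pi * \<eta> * x) \<partial>lborel) = trapezoid \<eta>"
proof -
  let ?g = "\<lambda>a x::real. (1 - cos (a * x)) / x\<^sup>2"
  have *: "vp_kernel x * cos (2 * pi * \<eta> * x) = (1 / (4 * pi * kappa)) *
      (?g (2 * pi * (2 + \<eta>)) x + ?g (2 * pi * (2 - \<eta>)) x
        - ?g (2 * pi * (1 + \<eta>)) x - ?g (2 * pi * (1 - \<eta>)) x)" for x
  proof -
    have "cos (2 * pi * x) * cos (2 * pi * \<eta> * x)
        = (cos (2 * pi * (1 - \<eta>) * x) + cos (2 * pi * (1 + \<eta>) * x)) / 2"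
      by (subst cos_times_cos) (simp add: algebra_simps)
    moreover have "cos (4 * pi * x) * cos (2 * pi * \<eta> * x)
        = (cos (2 * pi * (2 - \<eta>) * x) + cos (2 * pi * (2 + \<eta>) * x)) / 2"
      by (subst cos_times_cos) (simp add: algebra_simps)
    ultimately have PC: "(cos (2 * pi * x) - cos (4 * pi * x)) * cos (2 * pi * \<eta> * x)
      = ((1 - cos (2 * pi * (2 + \<eta>) * x)) + (1 - cos (2 * pi * (2 - \<eta>) * x))
        - (1 - cos (2 * pi * (1 + \<eta>) * x)) - (1 - cos (2 * pi * (1 - \<eta>) * x))) / 2"
      by (simp add: algebra_simps)
    have "vp_kernel x * cos (2 * pi * \<eta> * x) =
      (cos (2 * pi * x) - cos (4 * pi * x)) * cos (2 * pi * \<eta> * x) / x\<^sup>2 / (2 * pi * kappa)"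
      by (simp add: vp_kernel_def)
    hence eq: "vp_kernel x * cos (2 * pi * \<eta> * x) =
      ((1 - cos (2 * pi * (2 + \<eta>) * x)) + (1 - cos (2 * pi * (2 - \<eta>) * x))
        - (1 - cos (2 * pi * (1 + \<eta>) * x)) - (1 - cos (2 * pi * (1 - \<eta>) * x))) / 2 / x\<^sup>2 / (2 * pi * kappa)"
      unfolding PC .
    show ?thesis unfolding eq
      by (simp add: add_divide_distrib[symmetric] diff_divide_distrib[symmetric] del: distrib_left_numeral)
  qed
  have "(\<integral>x. vp_kernel x * cos (2 * pi * \<eta> * x) \<partial>lborel) = (1 / (4 * pi * kappa)) *
      (\<bar>2 * pi * (2 + \<eta>)\<bar> * kappa + \<bar>2 * pi * (2 - \<eta>)\<bar> * kappa
        - \<bar>2 * pi * (1 + \<eta>)\<bar> * kappa - \<bar>2 * pi * (1 - \<eta>)\<bar> * kappa)"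
    unfolding * integral_mult_right_zero
    by (simp add: Bochner_Integration.integral_add Bochner_Integration.integral_diff
        integrable_one_minus_cos_div integral_one_minus_cos_div del: distrib_left_numeral)
  also have "\<dots> = trapezoid \<eta>"
  proof -
    have "\<bar>2 * pi * y\<bar> = 2 * pi * \<bar>y\<bar>" for y
      by (simp add: abs_mult)
    thus ?thesis
      using kappa_pos pi_gt_zero by (simp only: trapezoid_def) (simp add: field_simps)
  qed
  finally show ?thesis .
qed

lemma trapezoid_eq_1: "\<bar>\<eta>\<bar> \<le> 1 \<Longrightarrow> trapezoid \<eta> = 1"
  and trapezoid_eq_0: "2 \<le> \<bar>\<eta>\<bar> \<Longrightarrow> trapezoid \<eta> = 0"
  and trapezoid_bounds: "0 \<le> trapezoid \<eta>" "trapezoid \<eta> \<le> 1"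
  by (auto simp: trapezoid_def)

lemma integrable_vp_kernel_cis:
  "integrable lborel (\<lambda>x. complex_of_real (vp_kernel x) * cis (c * x))"
proof (rule Bochner_Integration.integrable_bound[OF integrable_vp_kernel])
  show "(\<lambda>x. complex_of_real (vp_kernel x) * cis (c * x)) \<in> borel_measurable lborel"
    by (intro borel_measurable_times borel_measurable_of_real)
       (auto intro!: borel_measurable_continuous_onI continuous_intros)
qed (simp add: norm_mult)

lemma integral_vp_kernel_cis:
  "(\<integral>x. complex_of_real (vp_kernel x) * cis (2 * pi * \<eta> * x) \<partial>lborel) = trapezoid \<eta>"
proof (rule complex_eqI)
  note int = integrable_vp_kernel_cis[of "2 * pi * \<eta>"]
  show "Re (\<integral>x. vp_kernel x * cis (2 * pi * \<eta> * x) \<partial>lborel) = Re (trapezoid \<eta>)"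
    using integral_Re[OF int] integral_vp_kernel_cos[of \<eta>] by simp
  have "(\<integral>x. vp_kernel x * sin (2 * pi * \<eta> * x) \<partial>lborel) = 0"
    by (rule integral_odd_eq_0) simp
  thus "Im (\<integral>x. vp_kernel x * cis (2 * pi * \<eta> * x) \<partial>lborel) = Im (trapezoid \<eta>)"
    using integral_Im[OF int] by simp
qed

text \<open>Needed because \<open>Lp_multiplier\<close> speaks only of functions with integrable
  Fourier transform, and the transforms of the test functions below carry this factor.\<close>

lemma integrable_trapezoid: "integrable lborel trapezoid"
proof (rule integrableI_bounded_set[where A = "{-2..2}" and B = 1])
  have "continuous_on UNIV trapezoid"
    unfolding trapezoid_def by (intro continuous_intros) auto
  thus "trapezoid \<in> borel_measurable lborel"
    by (simp add: borel_measurable_continuous_onI)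
  show "AE x in lborel. x \<in> {-2..2} \<longrightarrow> norm (trapezoid x) \<le> 1"
    using trapezoid_bounds by (intro AE_I2) simp
  show "AE x in lborel. x \<notin> {-2..2} \<longrightarrow> trapezoid x = 0"
    by (intro AE_I2) (auto intro: trapezoid_eq_0)
qed auto

section \<open>Sums of the kernel over an arithmetic progression\<close>

text \<open>Shifting the index by the floor of \<open>x / \<epsilon>\<close> leaves an offset in
  \<open>{0..1}\<close>, which makes the comparison with the sum over all integers \<open>j\<close>
  of \<open>1 / (1 + j\<^sup>2)\<close> uniform in \<open>x\<close>.\<close>

lemma sampled_decay_bound:
  fixes \<epsilon> :: real
  assumes "0 < \<epsilon>"
  shows "\<exists>D>0. \<forall>x. \<forall>A. finite A \<longrightarrow> (\<Sum>k\<in>A. 1 / (1 + (x - \<epsilon> * of_int k)\<^sup>2)) \<le> D"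
proof -
  define D0 where "D0 = (\<Sum>\<^sub>\<infinity>j::int. 1 / (1 + (of_int j)\<^sup>2 :: real))"
  have nat: "summable (\<lambda>n. 1 / (1 + (real n)\<^sup>2))"
    by (rule summable_comparison_test'[OF inverse_power_summable[of 2], where N = 1])
       (auto simp: divide_simps add_nonneg_eq_0_iff add_pos_nonneg)
  hence nat': "(\<lambda>n. 1 / (1 + (real n)\<^sup>2)) summable_on UNIV"
    by (subst summable_on_UNIV_nonneg_real_iff) auto
  have "(\<lambda>j::int. 1 / (1 + (of_int j)\<^sup>2 :: real)) summable_on (range int \<union> range (\<lambda>n. - int n))"
  proof (rule summable_on_union)
    show "(\<lambda>j::int. 1 / (1 + (of_int j)\<^sup>2 :: real)) summable_on (range int)"
      using nat' by (subst summable_on_reindex) (auto simp: o_def)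
    show "(\<lambda>j::int. 1 / (1 + (of_int j)\<^sup>2 :: real)) summable_on (range (\<lambda>n. - int n))"
      using nat' by (subst summable_on_reindex) (auto simp: o_def inj_on_def)
  qed
  moreover have "range int \<union> range (\<lambda>n. - int n) = UNIV"
    by (auto simp: image_iff) (metis int_cases2)
  ultimately have summ: "(\<lambda>j::int. 1 / (1 + (of_int j)\<^sup>2 :: real)) summable_on UNIV"
    by simp
  have D0: "(\<Sum>j\<in>A. 1 / (1 + (of_int j)\<^sup>2 :: real)) \<le> D0" if "finite A" for A :: "int set"
    unfolding D0_def using that by (intro finite_sum_le_infsum summ) auto
  have "D0 > 0"
    using D0[of "{0}"] by simp
  \<comment> \<open>The 3 comes from \<open>1 + (t - s)\<^sup>2 \<le> 3 + 2 * s\<^sup>2\<close> for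
    \<open>t\<close> in \<open>{0..1}\<close>; the other factor pays for replacing \<open>s\<close>
    by \<open>\<epsilon> * s\<close>.\<close>
  define c where "c = 3 * (1 + 1 / \<epsilon>\<^sup>2)"
  have "c > 0" using assms by (simp add: c_def add_pos_nonneg)
  have "(\<Sum>k\<in>A. 1 / (1 + (x - \<epsilon> * of_int k)\<^sup>2)) \<le> c * D0" if "finite A" for x A
  proof -
    define k0 where "k0 = \<lfloor>x / \<epsilon>\<rfloor>"
    define t where "t = x / \<epsilon> - of_int k0"
    have t: "0 \<le> t" "t \<le> 1"
      unfolding t_def k0_def by linarith+
    have x: "x = \<epsilon> * (of_int k0 + t)"
      using assms by (simp add: t_def)
    have term_le: "1 / (1 + (x - \<epsilon> * of_int k)\<^sup>2) \<le> c * (1 / (1 + (of_int (k - k0))\<^sup>2))" for k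
    proof -
      define s where "s = t - of_int (k - k0)"
      have "1 + (of_int (k - k0))\<^sup>2 = 1 + (t - s)\<^sup>2"
        by (simp add: s_def)
      also have "\<dots> \<le> 3 + 2 * s\<^sup>2"
      proof -
        have "t\<^sup>2 \<le> 1" using t by (simp add: abs_square_le_1)
        moreover have "0 \<le> (t + s)\<^sup>2" by simp
        ultimately show ?thesis unfolding power2_diff power2_sum by linarith
      qed
      also have "\<dots> \<le> c * (1 + (\<epsilon> * s)\<^sup>2)"
        using assms by (simp add: c_def field_simps power_mult_distrib)
      finally have "1 + (of_int (k - k0))\<^sup>2 \<le> c * (1 + (\<epsilon> * s)\<^sup>2)" .
      moreover have "x - \<epsilon> * of_int k = \<epsilon> * s"
        unfolding x s_def by (simp add: algebra_simps)
      ultimately show ?thesis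
        by (simp add: divide_simps add_nonneg_eq_0_iff add_pos_nonneg)
    qed
    have "(\<Sum>k\<in>A. 1 / (1 + (x - \<epsilon> * of_int k)\<^sup>2))
        \<le> c * (\<Sum>k\<in>A. 1 / (1 + (of_int (k - k0))\<^sup>2))"
      unfolding sum_distrib_left by (intro sum_mono term_le)
    also have "(\<Sum>k\<in>A. 1 / (1 + (of_int (k - k0))\<^sup>2 :: real))
        = (\<Sum>j\<in>(\<lambda>k. k - k0) ` A. 1 / (1 + (of_int j)\<^sup>2))"
      by (subst sum.reindex) (auto simp: inj_on_def)
    also have "c * \<dots> \<le> c * D0"
      using \<open>c > 0\<close> \<open>finite A\<close> by (intro mult_left_mono D0) auto
    finally show ?thesis .
  qed
  moreover have "c * D0 > 0" using \<open>c > 0\<close> \<open>D0 > 0\<close> by simp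
  ultimately show ?thesis by blast
qed

lemma sampled_vp_kernel_bound:
  fixes \<epsilon> :: real
  assumes "0 < \<epsilon>"
  shows "\<exists>D>0. \<forall>x. \<forall>A. finite A \<longrightarrow> (\<Sum>k\<in>A. \<bar>vp_kernel (x - \<epsilon> * of_int k)\<bar>) \<le> D"
proof -
  obtain C where C: "C > 0" "\<And>x. \<bar>vp_kernel x\<bar> \<le> C / (1 + x\<^sup>2)"
    using vp_kernel_bound by blast
  obtain D where D: "D > 0" "\<And>x A. finite A \<Longrightarrow> (\<Sum>k\<in>A. 1 / (1 + (x - \<epsilon> * of_int k)\<^sup>2)) \<le> D"
    using sampled_decay_bound[OF assms] by blast
  have "(\<Sum>k\<in>A. \<bar>vp_kernel (x - \<epsilon> * of_int k)\<bar>) \<le> C * D" if "finite A" for x A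
  proof -
    have "(\<Sum>k\<in>A. \<bar>vp_kernel (x - \<epsilon> * of_int k)\<bar>)
        \<le> C * (\<Sum>k\<in>A. 1 / (1 + (x - \<epsilon> * of_int k)\<^sup>2))"
      unfolding sum_distrib_left using C(2) by (intro sum_mono) simp
    also have "\<dots> \<le> C * D"
      using C(1) D(2)[OF that] by (intro mult_left_mono) auto
    finally show ?thesis .
  qed
  moreover have "C * D > 0" using C(1) D(1) by simp
  ultimately show ?thesis by blast
qed

section \<open>Transference from the line to the integers\<close>

text \<open>Convexity of the power function in the form of its tangent at \<open>l\<close>.
  Multiplying the tangent inequality by \<open>s\<close> yields the next one up to the nonnegative
  term \<open>real (Suc p) * l ^ p * (s - l)\<^sup>2\<close>.\<close>

lemma power_ge_tangent:
  fixes s l :: real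
  assumes "0 \<le> s" "0 \<le> l"
  shows "l ^ Suc p + real (Suc p) * l ^ p * (s - l) \<le> s ^ Suc p"
proof (induction p)
  case (Suc p)
  have "l ^ Suc (Suc p) + real (Suc (Suc p)) * l ^ Suc p * (s - l)
      \<le> l ^ Suc (Suc p) + real (Suc (Suc p)) * l ^ Suc p * (s - l)
        + real (Suc p) * l ^ p * (s - l)\<^sup>2"
    using assms by simp
  also have "\<dots> = s * (l ^ Suc p + real (Suc p) * l ^ p * (s - l))"
    by (simp add: algebra_simps power2_eq_square)
  also have "\<dots> \<le> s * s ^ Suc p"
    using assms by (intro mult_left_mono Suc) auto
  finally show ?case by simp
qed simp

text \<open>Jensen's inequality for the measure with density \<open>w\<close>: integrate the tangent
  inequality taken at the mean value. For total weight 0 there is no mean, but then \<open>w\<close>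
  vanishes almost everywhere.\<close>

lemma weighted_power_mean:
  fixes w s :: "'a \<Rightarrow> real"
  assumes "1 \<le> p" and w: "integrable M w" "\<And>x. 0 \<le> w x" and s: "\<And>x. 0 \<le> s x"
    and ws: "integrable M (\<lambda>x. w x * s x)" and wsp: "integrable M (\<lambda>x. w x * s x ^ p)"
  shows "(\<integral>x. w x * s x \<partial>M) ^ p \<le> (\<integral>x. w x \<partial>M) ^ (p - 1) * (\<integral>x. w x * s x ^ p \<partial>M)"
proof -
  obtain k where p: "p = Suc k" using \<open>1 \<le> p\<close> by (cases p) auto
  define W where "W = (\<integral>x. w x \<partial>M)"
  have "0 \<le> W" unfolding W_def using w(2) by simp
  show ?thesis
  proof (cases "W = 0")
    case True
    have "AE x in M. w x = 0"
      using integral_nonneg_eq_0_iff_AE[OF w(1)] w(2) True unfolding W_def by simp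
    hence "(\<integral>x. w x * s x \<partial>M) = (\<integral>x. 0 \<partial>M)"
      using ws by (intro integral_cong_AE) auto
    moreover have "0 \<le> (\<integral>x. w x \<partial>M) ^ (p - 1) * (\<integral>x. w x * s x ^ p \<partial>M)"
      using w(2) s by (intro mult_nonneg_nonneg zero_le_power integral_nonneg_AE) auto
    ultimately show ?thesis using p by simp
  next
    case False
    \<comment> \<open>At the weighted mean the linear term of the tangent integrates to
      zero.\<close>
    define l where "l = (\<integral>x. w x * s x \<partial>M) / W"
    have "0 \<le> l"
      unfolding l_def using w(2) s \<open>0 \<le> W\<close> by (intro divide_nonneg_nonneg integral_nonneg_AE) auto
    have "(\<integral>x. (l ^ Suc k - real (Suc k) * l ^ k * l) * w x + real (Suc k) * l ^ k * (w x * s x) \<partial>M)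
        \<le> (\<integral>x. w x * s x ^ p \<partial>M)"
    proof (rule integral_mono)
      show "(l ^ Suc k - real (Suc k) * l ^ k * l) * w x + real (Suc k) * l ^ k * (w x * s x)
          \<le> w x * s x ^ p" for x
        using mult_left_mono[OF power_ge_tangent[OF s[of x] \<open>0 \<le> l\<close>, of k] w(2)[of x]]
        by (simp add: p algebra_simps)
    qed (use w ws wsp in auto)
    also have "(\<integral>x. (l ^ Suc k - real (Suc k) * l ^ k * l) * w x + real (Suc k) * l ^ k * (w x * s x) \<partial>M)
        = (l ^ Suc k - real (Suc k) * l ^ k * l) * W + real (Suc k) * l ^ k * (l * W)"
      using w ws False by (simp add: W_def[symmetric] l_def)
    also have "\<dots> = l ^ Suc k * W" by (simp add: algebra_simps)
    finally have "W ^ k * (l ^ Suc k * W) \<le> W ^ k * (\<integral>x. w x * s x ^ p \<partial>M)"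
      using \<open>0 \<le> W\<close> by (intro mult_left_mono) auto
    moreover have "W ^ k * (l ^ Suc k * W) = (\<integral>x. w x * s x \<partial>M) ^ p"
      using False by (simp add: l_def p power_divide)
    ultimately show ?thesis by (simp add: W_def p)
  qed
qed

lemma weighted_power_mean_sum:
  fixes w s :: "'a \<Rightarrow> real"
  assumes "1 \<le> p" "finite A" "\<And>x. 0 \<le> w x" "\<And>x. 0 \<le> s x"
  shows "(\<Sum>x\<in>A. w x * s x) ^ p \<le> (\<Sum>x\<in>A. w x) ^ (p - 1) * (\<Sum>x\<in>A. w x * s x ^ p)"
  using weighted_power_mean[of p "count_space A" w s] assms
  by (simp add: lebesgue_integral_count_space_finite integrable_count_space)

text \<open>The exponent 0 is excluded because \<open>0 powr 0\<close> is 0 while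
  \<open>0 ^ 0\<close> is 1.\<close>

lemma powr_of_nat: "x powr real p = x ^ p" if "0 \<le> x" "1 \<le> p"
  using that by (cases "x = 0") (simp_all add: powr_realpow)

text \<open>For Fubini's theorem: multipliers are only Lebesgue measurable, so the frequency
  variable is integrated over \<open>lebesgue\<close>, not \<open>lborel\<close>.\<close>

lemma sigma_finite_lebesgue: "sigma_finite_measure (lebesgue :: real measure)"
proof
  obtain A :: "real set set" where A: "countable A" "A \<subseteq> sets lborel" "\<Union>A = space lborel"
      "\<forall>a\<in>A. emeasure lborel a \<noteq> \<infinity>"
    using lborel.sigma_finite_countable by blast
  show "\<exists>A. countable A \<and> A \<subseteq> sets lebesgue \<and> \<Union>A = space (lebesgue :: real measure) \<and>
      (\<forall>a\<in>A. emeasure (lebesgue :: real measure) a \<noteq> \<infinity>)"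
    using A by (intro exI[of _ A]) (auto simp: emeasure_completion subset_iff)
qed

lemma borel_measurable_cis [measurable]: "cis \<in> borel_measurable borel"
  by (intro borel_measurable_continuous_onI continuous_intros)

section \<open>Band-limited interpolation of a finite sequence\<close>

definition trig_sum :: "int set \<Rightarrow> (int \<Rightarrow> complex) \<Rightarrow> real \<Rightarrow> complex" where
  "trig_sum A b \<xi> = (\<Sum>k\<in>A. b k * cis (- 2 * pi * of_int k * \<xi>))"

lemma borel_measurable_trig_sum [measurable]: "trig_sum A b \<in> borel_measurable borel"
  unfolding trig_sum_def by measurable

lemma norm_trig_sum_le: "norm (trig_sum A b \<xi>) \<le> (\<Sum>k\<in>A. norm (b k))"
  unfolding trig_sum_def by (rule sum_norm_le) (simp add: norm_mult)

text \<open>The value at \<open>\<epsilon> * of_int k\<close> need not be \<open>b k\<close>. What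
  matters is that the Fourier transform agrees on \<open>{-1..1}\<close> with the trigonometric
  polynomial of \<open>b\<close>, rescaled by \<open>\<epsilon>\<close>.\<close>

definition interp :: "real \<Rightarrow> int set \<Rightarrow> (int \<Rightarrow> complex) \<Rightarrow> real \<Rightarrow> complex" where
  "interp \<epsilon> A b x = (\<Sum>k\<in>A. b k * vp_kernel (x - \<epsilon> * of_int k))"

lemma borel_measurable_interp [measurable]: "interp \<epsilon> A b \<in> borel_measurable borel"
  unfolding interp_def by measurable

lemma integrable_vp_kernel_shift: "integrable lborel (\<lambda>x. vp_kernel (x - t))"
  using lborel_integrable_real_affine[OF integrable_vp_kernel, of 1 "- t"] by simp

lemma integral_abs_vp_kernel_shift:
  "(\<integral>x. \<bar>vp_kernel (x - t)\<bar> \<partial>lborel) = (\<integral>x. \<bar>vp_kernel x\<bar> \<partial>lborel)"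
  using lborel_integral_real_affine[of 1 "\<lambda>x. \<bar>vp_kernel x\<bar>" "- t"] by simp

lemma integral_vp_kernel_shift_cis:
  "(\<integral>x. complex_of_real (vp_kernel (x - t)) * cis (2 * pi * \<eta> * x) \<partial>lborel)
     = cis (2 * pi * \<eta> * t) * trapezoid \<eta>"
proof -
  have "(\<integral>x. complex_of_real (vp_kernel (x - t)) * cis (2 * pi * \<eta> * x) \<partial>lborel)
      = (\<integral>x. cis (2 * pi * \<eta> * t) * (complex_of_real (vp_kernel x) * cis (2 * pi * \<eta> * x)) \<partial>lborel)"
    by (subst lborel_integral_real_affine[of 1 _ t]) (simp_all add: cis_mult algebra_simps)
  also have "\<dots> = cis (2 * pi * \<eta> * t) * trapezoid \<eta>"
    by (simp add: integral_vp_kernel_cis)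
  finally show ?thesis .
qed

lemma trapezoid_minus [simp]: "trapezoid (- \<eta>) = trapezoid \<eta>"
  by (simp add: trapezoid_def)

lemma borel_measurable_trapezoid [measurable]: "trapezoid \<in> borel_measurable borel"
  unfolding trapezoid_def by measurable

lemma integrable_interp: "integrable lborel (interp \<epsilon> A b)"
  unfolding interp_def
  by (intro Bochner_Integration.integrable_sum integrable_mult_right integrable_of_real
      integrable_vp_kernel_shift)

lemma fourier_interp: "fourier (interp \<epsilon> A b) \<xi> = trig_sum A b (\<epsilon> * \<xi>) * trapezoid \<xi>"
proof -
  have int: "integrable lborel (\<lambda>x. complex_of_real (vp_kernel (x - t)) * cis (2 * pi * (- \<xi>) * x))" for t
    by (rule Bochner_Integration.integrable_bound[OF integrable_vp_kernel_shift[of t]]) (auto simp: norm_mult)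
  have "fourier (interp \<epsilon> A b) \<xi> = (\<integral>x. interp \<epsilon> A b x * cis (- 2 * pi * x * \<xi>) \<partial>lborel)"
    unfolding fourier_def by (rule integral_completion) measurable
  also have "\<dots> = (\<integral>x. (\<Sum>k\<in>A. b k * (complex_of_real (vp_kernel (x - \<epsilon> * of_int k)) * cis (2 * pi * (- \<xi>) * x))) \<partial>lborel)"
    unfolding interp_def sum_distrib_right by (simp add: mult_ac)
  also have "\<dots> = (\<Sum>k\<in>A. b k * (\<integral>x. complex_of_real (vp_kernel (x - \<epsilon> * of_int k)) * cis (2 * pi * (- \<xi>) * x) \<partial>lborel))"
    by (subst Bochner_Integration.integral_sum) (use int in auto)
  also have "\<dots> = trig_sum A b (\<epsilon> * \<xi>) * trapezoid \<xi>"
    unfolding integral_vp_kernel_shift_cis trig_sum_def sum_distrib_right by (simp add: mult_ac)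
  finally show ?thesis .
qed

lemma integrable_fourier_interp: "integrable lebesgue (fourier (interp \<epsilon> A b))"
proof -
  have "integrable lborel (\<lambda>\<xi>. trig_sum A b (\<epsilon> * \<xi>) * trapezoid \<xi>)"
  proof (rule Bochner_Integration.integrable_bound)
    show "integrable lborel (\<lambda>\<xi>. (\<Sum>k\<in>A. norm (b k)) * trapezoid \<xi>)"
      by (intro integrable_mult_right integrable_trapezoid)
    show "AE \<xi> in lborel. norm (trig_sum A b (\<epsilon> * \<xi>) * trapezoid \<xi>)
        \<le> norm ((\<Sum>k\<in>A. norm (b k)) * trapezoid \<xi>)"
      by (intro AE_I2)
        (auto simp: norm_mult abs_mult sum_nonneg intro!: mult_right_mono norm_trig_sum_le)
  qed measurable
  thus ?thesis
    unfolding fourier_interp by (subst integrable_completion) auto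
qed

text \<open>A Schur test: the power mean inequality in \<open>k\<close>, with the kernel values as
  weights, costs \<open>D ^ (P - 1)\<close>; integrating in \<open>x\<close> gives the same kernel
  integral for every translate.\<close>

lemma interp_power_integral_bound:
  assumes "1 \<le> P" "finite A" "0 < D"
    and D: "\<And>x. (\<Sum>k\<in>A. \<bar>vp_kernel (x - \<epsilon> * of_int k)\<bar>) \<le> D"
  shows "integrable lborel (\<lambda>x. norm (interp \<epsilon> A b x) ^ P)"
    and "(\<integral>x. norm (interp \<epsilon> A b x) ^ P \<partial>lborel)
       \<le> D ^ (P - 1) * (\<integral>x. \<bar>vp_kernel x\<bar> \<partial>lborel) * (\<Sum>k\<in>A. norm (b k) ^ P)"
proof -
  define R where "R x = D ^ (P - 1) * (\<Sum>k\<in>A. \<bar>vp_kernel (x - \<epsilon> * of_int k)\<bar> * norm (b k) ^ P)" for x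
  have le: "norm (interp \<epsilon> A b x) ^ P \<le> R x" for x
  proof -
    have "norm (interp \<epsilon> A b x) \<le> (\<Sum>k\<in>A. \<bar>vp_kernel (x - \<epsilon> * of_int k)\<bar> * norm (b k))"
      unfolding interp_def by (rule sum_norm_le) (simp add: norm_mult)
    hence "norm (interp \<epsilon> A b x) ^ P \<le> (\<Sum>k\<in>A. \<bar>vp_kernel (x - \<epsilon> * of_int k)\<bar> * norm (b k)) ^ P"
      by (intro power_mono) auto
    also have "\<dots> \<le> (\<Sum>k\<in>A. \<bar>vp_kernel (x - \<epsilon> * of_int k)\<bar>) ^ (P - 1)
        * (\<Sum>k\<in>A. \<bar>vp_kernel (x - \<epsilon> * of_int k)\<bar> * norm (b k) ^ P)"
      using assms by (intro weighted_power_mean_sum) auto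
    also have "\<dots> \<le> R x"
      unfolding R_def by (intro mult_right_mono power_mono D sum_nonneg) auto
    finally show ?thesis .
  qed
  have intR: "integrable lborel R"
    unfolding R_def by (intro integrable_mult_right Bochner_Integration.integrable_sum
        integrable_mult_left integrable_abs integrable_vp_kernel_shift)
  show int: "integrable lborel (\<lambda>x. norm (interp \<epsilon> A b x) ^ P)"
    by (rule Bochner_Integration.integrable_bound[OF intR])
       (auto intro!: AE_I2 order_trans[OF le])
  have "(\<integral>x. norm (interp \<epsilon> A b x) ^ P \<partial>lborel) \<le> (\<integral>x. R x \<partial>lborel)"
    by (intro integral_mono int intR le)
  also have "\<dots> = D ^ (P - 1) * (\<Sum>k\<in>A. (\<integral>x. \<bar>vp_kernel x\<bar> \<partial>lborel) * norm (b k) ^ P)"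
    unfolding R_def
    by (simp add: Bochner_Integration.integral_sum integrable_vp_kernel_shift
        integral_abs_vp_kernel_shift)
  finally show "(\<integral>x. norm (interp \<epsilon> A b x) ^ P \<partial>lborel)
       \<le> D ^ (P - 1) * (\<integral>x. \<bar>vp_kernel x\<bar> \<partial>lborel) * (\<Sum>k\<in>A. norm (b k) ^ P)"
    by (simp add: sum_distrib_left mult_ac)
qed

section \<open>Sampling of band-limited functions\<close>

lemma integrable_of_bounded_support:
  fixes g :: "real \<Rightarrow> complex"
  assumes "g \<in> borel_measurable lebesgue" "\<And>x. norm (g x) \<le> B" "\<And>x. x \<notin> {u..v} \<Longrightarrow> g x = 0"
  shows "integrable lebesgue g"
  by (rule integrableI_bounded_set[where A = "{u..v}" and B = B])
     (use assms in \<open>auto simp: emeasure_completion emeasure_lborel_Icc_eq\<close>)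

lemma borel_measurable_fst_lebesgue:
    "fst \<in> borel_measurable ((lborel :: real measure) \<Otimes>\<^sub>M (lebesgue :: real measure))"
  and borel_measurable_snd_lebesgue:
    "snd \<in> borel_measurable ((lborel :: real measure) \<Otimes>\<^sub>M (lebesgue :: real measure))"
proof -
  have "(\<lambda>x::real. x) \<in> borel_measurable lebesgue"
    by (rule measurable_completion) simp
  show "snd \<in> borel_measurable ((lborel :: real measure) \<Otimes>\<^sub>M (lebesgue :: real measure))"
    by (rule measurable_compose[OF measurable_snd \<open>(\<lambda>x::real. x) \<in> borel_measurable lebesgue\<close>])
  have "(\<lambda>x::real. x) \<in> borel_measurable lborel" by simp
  show "fst \<in> borel_measurable ((lborel :: real measure) \<Otimes>\<^sub>M (lebesgue :: real measure))"
    by (rule measurable_compose[OF measurable_fst \<open>(\<lambda>x::real. x) \<in> borel_measurable lborel\<close>])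
qed

lemma borel_measurable_inv_fourier:
  assumes [measurable]: "g \<in> borel_measurable lebesgue"
  shows "inv_fourier g \<in> borel_measurable borel"
proof -
  interpret leb: sigma_finite_measure "lebesgue :: real measure"
    by (rule sigma_finite_lebesgue)
  have "(\<lambda>x. \<integral>\<xi>. g \<xi> * cis (2 * pi * x * \<xi>) \<partial>lebesgue) \<in> borel_measurable lborel"
  proof (rule leb.borel_measurable_lebesgue_integral)
    have "(\<lambda>z. g (snd z) * cis (2 * pi * fst z * snd z)) \<in> borel_measurable (lborel \<Otimes>\<^sub>M lebesgue)"
      by (intro borel_measurable_times measurable_compose[OF _ borel_measurable_cis]
          measurable_compose[OF measurable_snd assms] borel_measurable_const
          borel_measurable_fst_lebesgue borel_measurable_snd_lebesgue)
    thus "(\<lambda>(x, \<xi>). g \<xi> * cis (2 * pi * x * \<xi>)) \<in> borel_measurable (lborel \<Otimes>\<^sub>M lebesgue)"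
      by (simp add: case_prod_unfold)
  qed
  thus ?thesis unfolding inv_fourier_def[abs_def] by simp
qed

lemma norm_inv_fourier_le:
  "norm (inv_fourier g x) \<le> (\<integral>\<xi>. norm (g \<xi>) \<partial>lebesgue)"
  using integral_norm_bound[of lebesgue "\<lambda>\<xi>. g \<xi> * cis (2 * pi * x * \<xi>)"]
  by (simp add: inv_fourier_def norm_mult)

text \<open>By Fubini, integration against the translated kernel multiplies \<open>g\<close> by
  \<open>trapezoid\<close>, which is 1 wherever \<open>g\<close> lives.\<close>

lemma inv_fourier_reproducing:
  assumes g: "integrable lebesgue g" and supp: "\<And>\<xi>. 1 < \<bar>\<xi>\<bar> \<Longrightarrow> g \<xi> = 0"
  shows "(\<integral>y. inv_fourier g y * vp_kernel (y - x) \<partial>lborel) = inv_fourier g x"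
proof -
  interpret leb: sigma_finite_measure "lebesgue :: real measure"
    by (rule sigma_finite_lebesgue)
  interpret pr: pair_sigma_finite lborel "lebesgue :: real measure" ..
  define f where "f y \<xi> = g \<xi> * cis (2 * pi * y * \<xi>) * complex_of_real (vp_kernel (y - x))" for y \<xi>
  have gm [measurable]: "g \<in> borel_measurable lebesgue"
    using g by simp
  have meas: "case_prod f \<in> borel_measurable (lborel \<Otimes>\<^sub>M lebesgue)"
  proof -
    have "(\<lambda>z. g (snd z) * cis (2 * pi * fst z * snd z) * complex_of_real (vp_kernel (fst z - x)))
        \<in> borel_measurable (lborel \<Otimes>\<^sub>M lebesgue)"
    proof (intro borel_measurable_times)
      have "(\<lambda>y. complex_of_real (vp_kernel (y - x))) \<in> borel_measurable borel"
        by measurable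
      from measurable_compose[OF borel_measurable_fst_lebesgue this]
      show "(\<lambda>z. complex_of_real (vp_kernel (fst z - x))) \<in> borel_measurable (lborel \<Otimes>\<^sub>M lebesgue)"
        by simp
    qed (intro borel_measurable_times measurable_compose[OF _ borel_measurable_cis]
          measurable_compose[OF measurable_snd gm] borel_measurable_const
          borel_measurable_fst_lebesgue borel_measurable_snd_lebesgue)+
    thus ?thesis by (simp add: f_def case_prod_unfold)
  qed
  have nf: "norm (f y \<xi>) = norm (g \<xi>) * \<bar>vp_kernel (y - x)\<bar>" for y \<xi>
    by (simp add: f_def norm_mult)
  have "integrable (lborel \<Otimes>\<^sub>M lebesgue) (case_prod f)"
  proof (rule pr.Fubini_integrable)
    show "integrable lborel (\<lambda>y. \<integral>\<xi>. norm (case_prod f (y, \<xi>)) \<partial>lebesgue)"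
      using integrable_vp_kernel_shift[of x] by (simp add: nf)
    have "integrable lebesgue (\<lambda>\<xi>. f y \<xi>)" for y
    proof (rule Bochner_Integration.integrable_bound)
      show "integrable lebesgue (\<lambda>\<xi>. norm (g \<xi>) * \<bar>vp_kernel (y - x)\<bar>)"
        using g by simp
      have "(\<lambda>\<xi>::real. \<xi>) \<in> borel_measurable lebesgue"
        by (rule measurable_completion) simp
      thus "f y \<in> borel_measurable lebesgue"
        unfolding f_def
        by (intro borel_measurable_times gm borel_measurable_const measurable_compose[OF _ borel_measurable_cis])
           auto
    qed (simp add: nf)
    thus "AE y in lborel. integrable lebesgue (\<lambda>\<xi>. case_prod f (y, \<xi>))"
      by simp
  qed (rule meas)
  from pr.Fubini_integral[OF this]
  have "(\<integral>y. \<integral>\<xi>. f y \<xi> \<partial>lebesgue \<partial>lborel) = (\<integral>\<xi>. \<integral>y. f y \<xi> \<partial>lborel \<partial>lebesgue)"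
    by simp
  also have "(\<lambda>y. \<integral>\<xi>. f y \<xi> \<partial>lebesgue) = (\<lambda>y. inv_fourier g y * vp_kernel (y - x))"
    by (simp add: f_def inv_fourier_def)
  also have "(\<lambda>\<xi>. \<integral>y. f y \<xi> \<partial>lborel) = (\<lambda>\<xi>. g \<xi> * cis (2 * pi * x * \<xi>))"
  proof
    fix \<xi>
    have "(\<integral>y. f y \<xi> \<partial>lborel)
        = g \<xi> * (\<integral>y. complex_of_real (vp_kernel (y - x)) * cis (2 * pi * \<xi> * y) \<partial>lborel)"
      by (simp add: f_def mult_ac flip: integral_mult_right_zero)
    also have "\<dots> = g \<xi> * cis (2 * pi * x * \<xi>)"
      unfolding integral_vp_kernel_shift_cis using supp[of \<xi>]
      by (cases "\<bar>\<xi>\<bar> \<le> 1") (auto simp: trapezoid_eq_1 mult_ac)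
    finally show "(\<integral>y. f y \<xi> \<partial>lborel) = g \<xi> * cis (2 * pi * x * \<xi>)" .
  qed
  finally show ?thesis by (simp add: inv_fourier_def)
qed

text \<open>A Plancherel-Polya inequality. Each sample is recovered from the whole function by the
  reproducing formula. The roles in the Schur test are now exchanged: the kernel integral appears to
  the power \<open>P - 1\<close>, and the sum over the nodes appears once.\<close>

lemma sampling_inequality:
  assumes P: "1 \<le> P" and g: "integrable lebesgue g" and supp: "\<And>\<xi>. 1 < \<bar>\<xi>\<bar> \<Longrightarrow> g \<xi> = 0"
    and HP: "integrable lborel (\<lambda>x. norm (inv_fourier g x) ^ P)"
    and N: "finite N" and D: "\<And>x. (\<Sum>k\<in>N. \<bar>vp_kernel (x - \<epsilon> * of_int k)\<bar>) \<le> D"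
  shows "(\<Sum>n\<in>N. norm (inv_fourier g (\<epsilon> * of_int n)) ^ P)
    \<le> (\<integral>x. \<bar>vp_kernel x\<bar> \<partial>lborel) ^ (P - 1) * D * (\<integral>x. norm (inv_fourier g x) ^ P \<partial>lborel)"
proof -
  define H where "H = inv_fourier g"
  define \<Phi> where "\<Phi> = (\<integral>x. \<bar>vp_kernel x\<bar> \<partial>lborel)"
  define L where "L = (\<integral>\<xi>. norm (g \<xi>) \<partial>lebesgue)"
  have "0 \<le> \<Phi>" by (simp add: \<Phi>_def)
  have H_le: "norm (H x) \<le> L" for x
    unfolding H_def L_def by (rule norm_inv_fourier_le)
  have [measurable]: "H \<in> borel_measurable borel"
    unfolding H_def using g by (intro borel_measurable_inv_fourier) simp
  have int1: "integrable lborel (\<lambda>y. \<bar>vp_kernel (y - x)\<bar> * norm (H y))" for x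
    by (rule Bochner_Integration.integrable_bound
          [OF integrable_mult_right[OF integrable_vp_kernel_shift[of x], of L]])
       (use H_le order_trans[OF norm_ge_zero H_le] in
         \<open>auto simp: abs_mult mult.commute[of L] intro!: mult_left_mono\<close>)
  have intP: "integrable lborel (\<lambda>y. \<bar>vp_kernel (y - x)\<bar> * norm (H y) ^ P)" for x
    by (rule Bochner_Integration.integrable_bound
          [OF integrable_mult_right[OF integrable_vp_kernel_shift[of x], of "L ^ P"]])
       (use H_le order_trans[OF norm_ge_zero H_le] in
         \<open>auto simp: abs_mult mult.commute[of "L ^ P"] intro!: mult_left_mono power_mono\<close>)
  have pointwise: "norm (H x) ^ P \<le> \<Phi> ^ (P - 1) * (\<integral>y. \<bar>vp_kernel (y - x)\<bar> * norm (H y) ^ P \<partial>lborel)" for x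
  proof -
    have "H x = (\<integral>y. H y * vp_kernel (y - x) \<partial>lborel)"
      unfolding H_def by (rule inv_fourier_reproducing[OF g supp, symmetric])
    hence "norm (H x) \<le> (\<integral>y. norm (H y * vp_kernel (y - x)) \<partial>lborel)"
      by (simp only: integral_norm_bound)
    also have "\<dots> = (\<integral>y. \<bar>vp_kernel (y - x)\<bar> * norm (H y) \<partial>lborel)"
      by (simp add: norm_mult mult.commute)
    finally have "norm (H x) ^ P \<le> (\<integral>y. \<bar>vp_kernel (y - x)\<bar> * norm (H y) \<partial>lborel) ^ P"
      by (intro power_mono) auto
    also have "\<dots> \<le> (\<integral>y. \<bar>vp_kernel (y - x)\<bar> \<partial>lborel) ^ (P - 1)
        * (\<integral>y. \<bar>vp_kernel (y - x)\<bar> * norm (H y) ^ P \<partial>lborel)"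
      by (intro weighted_power_mean P int1 intP integrable_abs integrable_vp_kernel_shift) auto
    finally show ?thesis
      by (simp add: integral_abs_vp_kernel_shift \<Phi>_def)
  qed
  have "(\<Sum>n\<in>N. norm (H (\<epsilon> * of_int n)) ^ P)
      \<le> (\<Sum>n\<in>N. \<Phi> ^ (P - 1) * (\<integral>y. \<bar>vp_kernel (y - \<epsilon> * of_int n)\<bar> * norm (H y) ^ P \<partial>lborel))"
    by (intro sum_mono pointwise)
  also have "\<dots> = \<Phi> ^ (P - 1) *
      (\<integral>y. (\<Sum>n\<in>N. \<bar>vp_kernel (y - \<epsilon> * of_int n)\<bar>) * norm (H y) ^ P \<partial>lborel)"
    using intP by (simp add: sum_distrib_right Bochner_Integration.integral_sum flip: sum_distrib_left)
  also have "\<dots> \<le> \<Phi> ^ (P - 1) * (\<integral>y. D * norm (H y) ^ P \<partial>lborel)"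
  proof (intro mult_left_mono integral_mono)
    show "integrable lborel (\<lambda>y. (\<Sum>n\<in>N. \<bar>vp_kernel (y - \<epsilon> * of_int n)\<bar>) * norm (H y) ^ P)"
      unfolding sum_distrib_right by (intro Bochner_Integration.integrable_sum intP)
    show "integrable lborel (\<lambda>y. D * norm (H y) ^ P)"
      using HP by (simp add: H_def)
  qed (use D \<open>0 \<le> \<Phi>\<close> in \<open>auto intro!: mult_right_mono\<close>)
  finally show ?thesis by (simp add: H_def \<Phi>_def)
qed

lemma Lp_norm_power:
  fixes f :: "'a \<Rightarrow> 'b::real_normed_vector"
  assumes "1 \<le> P"
  shows "Lp_norm M (real P) f = (if integrable M (\<lambda>x. norm (f x) ^ P)
     then ennreal (root P (\<integral>x. norm (f x) ^ P \<partial>M)) else \<infinity>)"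
  using assms
  by (simp add: Lp_norm_def powr_of_nat root_powr_inverse)

text \<open>Interpolate, apply the multiplier on the line, sample. \<open>K\<close> is the product
  of the three bounds; it depends on \<open>\<epsilon>\<close> through \<open>D\<close>, but not on
  the finite sets or the sequence.\<close>

lemma transference:
  fixes m :: "real \<Rightarrow> complex" and \<epsilon> :: real
  assumes P: "1 \<le> P" and mult: "Lp_multiplier (real P) m"
    and supp: "\<And>\<xi>. 1 / 2 < \<bar>\<xi>\<bar> \<Longrightarrow> m \<xi> = 0" and "0 < \<epsilon>"
  shows "\<exists>K\<ge>0. \<forall>A b N. finite A \<longrightarrow> finite N \<longrightarrow>
    (\<Sum>n\<in>N. norm (inv_fourier (\<lambda>\<eta>. m \<eta> * trig_sum A b (\<epsilon> * \<eta>)) (\<epsilon> * of_int n)) ^ P)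
      \<le> K * (\<Sum>k\<in>A. norm (b k) ^ P)"
proof -
  obtain D where D: "0 < D" "\<And>x A. finite A \<Longrightarrow> (\<Sum>k\<in>A. \<bar>vp_kernel (x - \<epsilon> * of_int k)\<bar>) \<le> D"
    using sampled_vp_kernel_bound[OF \<open>0 < \<epsilon>\<close>] by blast
  obtain M where M: "\<And>\<xi>. norm (m \<xi>) \<le> M"
    using mult unfolding Lp_multiplier_def bounded_iff by auto
  have m [measurable]: "m \<in> borel_measurable lebesgue"
    using mult unfolding Lp_multiplier_def by simp
  obtain a' where a': "\<And>f. integrable lebesgue f \<Longrightarrow> integrable lebesgue (fourier f) \<Longrightarrow>
      Lp_norm lebesgue (real P) f < \<infinity> \<Longrightarrow>
      Lp_norm lebesgue (real P) (multiplier_op m f) \<le> ennreal a' * Lp_norm lebesgue (real P) f"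
    using mult unfolding Lp_multiplier_def by blast
  \<comment> \<open>A negative constant in \<open>Lp_multiplier\<close> is truncated to 0 by
    \<open>ennreal\<close>; the computation with real numbers below needs a nonnegative one.\<close>
  define a where "a = max a' 0"
  have "0 \<le> a" by (simp add: a_def)
  have a: "Lp_norm lebesgue (real P) (multiplier_op m f) \<le> ennreal a * Lp_norm lebesgue (real P) f"
    if "integrable lebesgue f" "integrable lebesgue (fourier f)" "Lp_norm lebesgue (real P) f < \<infinity>" for f
    using a'[OF that] by (rule order_trans) (auto simp: a_def intro!: mult_right_mono ennreal_leI)
  define \<Phi> where "\<Phi> = (\<integral>x. \<bar>vp_kernel x\<bar> \<partial>lborel)"
  have "0 \<le> \<Phi>" by (simp add: \<Phi>_def)
  define K where "K = \<Phi> ^ (P - 1) * D * (a ^ P * (D ^ (P - 1) * \<Phi>))"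
  have "0 \<le> K"
    using D(1) \<open>0 \<le> a\<close> \<open>0 \<le> \<Phi>\<close> by (simp add: K_def)
  moreover have "(\<Sum>n\<in>N. norm (inv_fourier (\<lambda>\<eta>. m \<eta> * trig_sum A b (\<epsilon> * \<eta>)) (\<epsilon> * of_int n)) ^ P)
      \<le> K * (\<Sum>k\<in>A. norm (b k) ^ P)" if A: "finite A" and N: "finite N" for A b N
  proof -
    define g where "g \<eta> = m \<eta> * trig_sum A b (\<epsilon> * \<eta>)" for \<eta>
    let ?F = "interp \<epsilon> A b"
    have gm [measurable]: "g \<in> borel_measurable lebesgue"
    proof -
      have "(\<lambda>\<eta>. trig_sum A b (\<epsilon> * \<eta>)) \<in> borel_measurable lebesgue"
        by (rule measurable_completion) measurable
      thus ?thesis unfolding g_def using m by (rule borel_measurable_times[rotated])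
    qed
    have g: "integrable lebesgue g"
    proof (rule integrable_of_bounded_support)
      show "norm (g x) \<le> M * (\<Sum>k\<in>A. norm (b k))" for x
        unfolding g_def norm_mult using M order_trans[OF norm_ge_zero M]
        by (intro mult_mono norm_trig_sum_le) auto
      show "g x = 0" if "x \<notin> {-1..1}" for x
        using that supp[of x] by (auto simp: g_def abs_if)
    qed (rule gm)
    \<comment> \<open>The factor \<open>trapezoid\<close> disappears: it is 1 on
      \<open>{-1..1}\<close>, and \<open>m\<close> vanishes elsewhere.\<close>
    have op: "multiplier_op m ?F = inv_fourier g"
    proof -
      have "(\<lambda>\<xi>. m \<xi> * fourier ?F \<xi>) = g"
      proof
        fix \<xi>
        show "m \<xi> * fourier ?F \<xi> = g \<xi>"
          by (cases "\<bar>\<xi>\<bar> \<le> 1") (auto simp: fourier_interp g_def trapezoid_eq_1 supp)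
      qed
      thus ?thesis by (simp add: multiplier_op_def)
    qed
    note F = interp_power_integral_bound[OF P A D(1) D(2)[OF A], where b = b]
    have Fleb: "integrable lebesgue (\<lambda>x. norm (?F x) ^ P)"
      using F(1) by (subst integrable_completion) auto
    have Feq: "(\<integral>x. norm (?F x) ^ P \<partial>lebesgue) = (\<integral>x. norm (?F x) ^ P \<partial>lborel)"
      by (rule integral_completion) measurable
    have Fnorm: "Lp_norm lebesgue (real P) ?F = ennreal (root P (\<integral>x. norm (?F x) ^ P \<partial>lborel))"
      unfolding Lp_norm_power[OF P] using Fleb Feq by simp
    have le: "Lp_norm lebesgue (real P) (inv_fourier g)
        \<le> ennreal (a * root P (\<integral>x. norm (?F x) ^ P \<partial>lborel))"
    proof -
      have "integrable lebesgue ?F"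
        using integrable_interp by (subst integrable_completion) auto
      from a[OF this integrable_fourier_interp] show ?thesis
        using \<open>0 \<le> a\<close> by (simp add: op Fnorm ennreal_mult')
    qed
    \<comment> \<open>A finite bound rules out the value \<open>\<infinity>\<close>, which
      \<open>Lp_norm\<close> takes exactly in the non-integrable case.\<close>
    hence Hleb: "integrable lebesgue (\<lambda>x. norm (inv_fourier g x) ^ P)"
      unfolding Lp_norm_power[OF P] by (auto split: if_splits simp: top_unique)
    have [measurable]: "inv_fourier g \<in> borel_measurable borel"
      by (rule borel_measurable_inv_fourier[OF gm])
    have H: "integrable lborel (\<lambda>x. norm (inv_fourier g x) ^ P)"
      using Hleb by (subst (asm) integrable_completion) auto
    have Heq: "(\<integral>x. norm (inv_fourier g x) ^ P \<partial>lebesgue) = (\<integral>x. norm (inv_fourier g x) ^ P \<partial>lborel)"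
      by (rule integral_completion) measurable
    have "root P (\<integral>x. norm (inv_fourier g x) ^ P \<partial>lborel) \<le> a * root P (\<integral>x. norm (?F x) ^ P \<partial>lborel)"
      using le Hleb \<open>0 \<le> a\<close> P by (simp add: Lp_norm_power[OF P] Heq)
    hence "(root P (\<integral>x. norm (inv_fourier g x) ^ P \<partial>lborel)) ^ P
        \<le> (a * root P (\<integral>x. norm (?F x) ^ P \<partial>lborel)) ^ P"
      using P by (intro power_mono) auto
    hence HF: "(\<integral>x. norm (inv_fourier g x) ^ P \<partial>lborel) \<le> a ^ P * (\<integral>x. norm (?F x) ^ P \<partial>lborel)"
      using P by (simp add: power_mult_distrib)
    have "(\<Sum>n\<in>N. norm (inv_fourier g (\<epsilon> * of_int n)) ^ P)
        \<le> \<Phi> ^ (P - 1) * D * (\<integral>x. norm (inv_fourier g x) ^ P \<partial>lborel)"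
      unfolding \<Phi>_def using D(2)[OF N] by (intro sampling_inequality P g H N) (auto simp: g_def supp)
    also have "\<dots> \<le> \<Phi> ^ (P - 1) * D * (a ^ P * (D ^ (P - 1) * \<Phi> * (\<Sum>k\<in>A. norm (b k) ^ P)))"
      using D(1) \<open>0 \<le> a\<close> \<open>0 \<le> \<Phi>\<close> F(2)
      by (intro mult_left_mono order_trans[OF HF]) (auto simp: \<Phi>_def)
    also have "\<dots> = K * (\<Sum>k\<in>A. norm (b k) ^ P)"
      by (simp add: K_def mult_ac)
    finally show ?thesis unfolding g_def .
  qed
  ultimately show ?thesis by blast
qed

section \<open>Frequency projections and their extension to sequence spaces\<close>

abbreviation (input) "int_counting \<equiv> count_space (UNIV :: int set)"

text \<open>The \<open>P\<close>-th power of the sequence norm. A nonnegative integral avoids both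
  roots and integrability tests: monotonicity and Fatou's lemma hold unconditionally.\<close>

definition energy :: "nat \<Rightarrow> (int \<Rightarrow> complex) \<Rightarrow> ennreal" where
  "energy P u = (\<integral>\<^sup>+n. ennreal (norm (u n) ^ P) \<partial>int_counting)"

lemma energy_finite_iff: "energy P u < \<infinity> \<longleftrightarrow> integrable int_counting (\<lambda>n. norm (u n) ^ P)"
  by (simp add: energy_def integrable_iff_bounded norm_power)

lemma energy_eq_integral:
  "energy P u < \<infinity> \<Longrightarrow> energy P u = ennreal (\<integral>n. norm (u n) ^ P \<partial>int_counting)"
  unfolding energy_finite_iff unfolding energy_def by (intro nn_integral_eq_integral) auto

lemma lp_norm_less_iff_energy:
  assumes "1 \<le> P" "0 < c"
  shows "lp_norm (real P) u < ennreal c \<longleftrightarrow> energy P u < ennreal (c ^ P)"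
proof (cases "energy P u < \<infinity>")
  case True
  have "root P (\<integral>n. norm (u n) ^ P \<partial>int_counting) < c \<longleftrightarrow> (\<integral>n. norm (u n) ^ P \<partial>int_counting) < c ^ P"
    using assms real_root_less_iff[of P "\<integral>n. norm (u n) ^ P \<partial>int_counting" "c ^ P"]
    by (simp add: real_root_power_cancel)
  thus ?thesis
    using True[unfolded energy_finite_iff] assms
    unfolding energy_eq_integral[OF True] Lp_norm_power[OF assms(1)]
    by (simp add: ennreal_less_iff)
next
  case False
  thus ?thesis
    unfolding Lp_norm_power[OF assms(1)] energy_finite_iff[symmetric] by (auto simp: not_less top_unique)
qed

lemma lp_norm_finite_iff_energy:
  "1 \<le> P \<Longrightarrow> lp_norm (real P) u < \<infinity> \<longleftrightarrow> energy P u < \<infinity>"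
  unfolding Lp_norm_power energy_finite_iff by auto

lemma lp_norm_tendsto_0_iff_energy:
  assumes "1 \<le> P"
  shows "(\<lambda>k. lp_norm (real P) (u k)) \<longlonglongrightarrow> 0 \<longleftrightarrow> (\<lambda>k. energy P (u k)) \<longlonglongrightarrow> 0"
proof
  assume L: "(\<lambda>k. lp_norm (real P) (u k)) \<longlonglongrightarrow> 0"
  show "(\<lambda>k. energy P (u k)) \<longlonglongrightarrow> 0"
  proof (rule tendsto_zero_ennreal)
    fix r :: real assume "0 < r"
    hence "eventually (\<lambda>k. lp_norm (real P) (u k) < ennreal (root P r)) sequentially"
      using assms by (intro order_tendstoD(2)[OF L]) (simp add: ennreal_less_zero_iff)
    thus "eventually (\<lambda>k. energy P (u k) < ennreal r) sequentially"
      using \<open>0 < r\<close> assms by (subst (asm) lp_norm_less_iff_energy) auto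
  qed
next
  assume L: "(\<lambda>k. energy P (u k)) \<longlonglongrightarrow> 0"
  show "(\<lambda>k. lp_norm (real P) (u k)) \<longlonglongrightarrow> 0"
  proof (rule tendsto_zero_ennreal)
    fix r :: real assume "0 < r"
    hence "eventually (\<lambda>k. energy P (u k) < ennreal (r ^ P)) sequentially"
      by (intro order_tendstoD(2)[OF L]) (simp add: ennreal_less_zero_iff)
    thus "eventually (\<lambda>k. lp_norm (real P) (u k) < ennreal r) sequentially"
      using \<open>0 < r\<close> assms by (subst lp_norm_less_iff_energy) auto
  qed
qed

text \<open>A sum is at most twice the larger summand. This crude form of Minkowski's inequality
  suffices, since it is only used for finiteness and for limits equal to zero.\<close>

lemma energy_add_le: "energy P (\<lambda>n. u n + v n) \<le> 2 ^ P * (energy P u + energy P v)"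
proof -
  have "norm (u n + v n) ^ P \<le> 2 ^ P * (norm (u n) ^ P + norm (v n) ^ P)" for n
  proof -
    have "norm (u n + v n) ^ P \<le> (2 * max (norm (u n)) (norm (v n))) ^ P"
      by (intro power_mono order_trans[OF norm_triangle_ineq]) auto
    also have "\<dots> = 2 ^ P * max (norm (u n)) (norm (v n)) ^ P"
      by (simp add: power_mult_distrib)
    also have "\<dots> \<le> 2 ^ P * (norm (u n) ^ P + norm (v n) ^ P)"
      by (intro mult_left_mono) (auto simp: max_def)
    finally show ?thesis .
  qed
  hence "energy P (\<lambda>n. u n + v n)
      \<le> (\<integral>\<^sup>+n. 2 ^ P * (ennreal (norm (u n) ^ P) + ennreal (norm (v n) ^ P)) \<partial>int_counting)"
    unfolding energy_def
    by (intro nn_integral_mono)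
       (simp add: ennreal_power flip: ennreal_plus ennreal_mult' ennreal_numeral)
  also have "\<dots> = 2 ^ P * (energy P u + energy P v)"
    by (simp add: energy_def nn_integral_cmult nn_integral_add)
  finally show ?thesis .
qed

lemma energy_minus_commute: "energy P (\<lambda>n. u n - v n) = energy P (\<lambda>n. v n - u n)"
  by (simp add: energy_def norm_minus_commute)

lemma energy_triangle:
  "energy P (\<lambda>n. u n - w n) \<le> 2 ^ P * (energy P (\<lambda>n. u n - v n) + energy P (\<lambda>n. v n - w n))"
  using energy_add_le[of P "\<lambda>n. u n - v n" "\<lambda>n. v n - w n"] by simp

lemma energy_fatou:
  assumes "\<And>n. (\<lambda>k. u k n) \<longlonglongrightarrow> v n" "\<And>k. energy P (u k) \<le> C"
  shows "energy P v \<le> C"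
proof -
  have "energy P v = (\<integral>\<^sup>+n. liminf (\<lambda>k. ennreal (norm (u k n) ^ P)) \<partial>int_counting)"
    unfolding energy_def
    by (intro nn_integral_cong lim_imp_Liminf[symmetric] tendsto_ennrealI tendsto_intros assms) simp
  also have "\<dots> \<le> liminf (\<lambda>k. energy P (u k))"
    unfolding energy_def by (rule nn_integral_liminf) simp
  also have "\<dots> \<le> limsup (\<lambda>k. energy P (u k))"
    by (rule Liminf_le_Limsup) simp
  also have "\<dots> \<le> C"
    by (intro Limsup_bounded always_eventually allI assms)
  finally show ?thesis .
qed

lemma power_norm_le_energy: "ennreal (norm (u n) ^ P) \<le> energy P u"
proof -
  have "ennreal (norm (u n) ^ P) = (\<integral>\<^sup>+k. ennreal (norm (u k) ^ P) * indicator {n} k \<partial>int_counting)"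
    by (subst nn_integral_count_space'[where A = "{n}"]) auto
  also have "\<dots> \<le> energy P u"
    unfolding energy_def by (intro nn_integral_mono) (auto simp: indicator_def)
  finally show ?thesis .
qed

lemma energy_tendsto_0_pointwise:
  assumes "1 \<le> P" "(\<lambda>k. energy P (\<lambda>n. u k n - v n)) \<longlonglongrightarrow> 0"
  shows "(\<lambda>k. u k n) \<longlonglongrightarrow> v n"
proof -
  have "(\<lambda>k. ennreal (norm (u k n - v n) ^ P)) \<longlonglongrightarrow> 0"
    using power_norm_le_energy[of "\<lambda>n. u _ n - v n"]
    by (intro tendsto_sandwich[OF _ _ tendsto_const assms(2)] always_eventually allI) auto
  hence "(\<lambda>k. norm (u k n - v n) ^ P) \<longlonglongrightarrow> 0"
    by (subst (asm) ennreal_tendsto_0_iff) auto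
  hence "(\<lambda>k. root P (norm (u k n - v n) ^ P)) \<longlonglongrightarrow> root P 0"
    by (rule tendsto_real_root)
  hence "(\<lambda>k. norm (u k n - v n)) \<longlonglongrightarrow> 0"
    using assms(1) by (simp add: real_root_power_cancel)
  thus ?thesis
    by (simp add: tendsto_norm_zero_iff LIM_zero_iff)
qed

definition truncate :: "nat \<Rightarrow> (int \<Rightarrow> complex) \<Rightarrow> int \<Rightarrow> complex" where
  "truncate k f n = (if \<bar>n\<bar> \<le> int k then f n else 0)"

lemma eventually_truncate_eq: "eventually (\<lambda>k. truncate k f n = f n) sequentially"
  using eventually_ge_at_top[of "nat \<bar>n\<bar>"] by eventually_elim (auto simp: truncate_def)

lemma truncate_tendsto: "(\<lambda>k. truncate k f n) \<longlonglongrightarrow> f n"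
  using eventually_truncate_eq by (rule tendsto_eventually)

lemma norm_truncate_le: "norm (truncate k f n) \<le> norm (f n)"
  by (simp add: truncate_def)

lemma truncate_eq_0: "n \<notin> {- int k..int k} \<Longrightarrow> truncate k f n = 0"
  by (auto simp: truncate_def)

lemma integrable_truncate: "integrable int_counting (truncate k f)"
proof -
  have "integrable int_counting (\<lambda>n. \<Sum>j\<in>{- int k..int k}. indicator {j} n *\<^sub>R f j)"
    by (intro Bochner_Integration.integrable_sum integrable_mult_indicator
        integrable_scaleR_left integrable_real_indicator) auto
  moreover have "truncate k f = (\<lambda>n. \<Sum>j\<in>{- int k..int k}. indicator {j} n *\<^sub>R f j)"
  proof
    fix n
    have "(\<Sum>j\<in>{- int k..int k}. indicator {j} n *\<^sub>R f j) = (\<Sum>j\<in>{- int k..int k}. if n = j then f j else 0)"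
      by (intro sum.cong) auto
    thus "truncate k f n = (\<Sum>j\<in>{- int k..int k}. indicator {j} n *\<^sub>R f j)"
      by (auto simp: truncate_def)
  qed
  ultimately show ?thesis by simp
qed

text \<open>Lets a single index control the errors of all later truncations.\<close>

lemma energy_truncate_antimono:
  "j \<le> k \<Longrightarrow> energy P (\<lambda>n. truncate k f n - f n) \<le> energy P (\<lambda>n. truncate j f n - f n)"
  unfolding energy_def
  by (intro nn_integral_mono ennreal_leI power_mono) (auto simp: truncate_def)

lemma energy_truncate_tendsto:
  assumes "1 \<le> P" "energy P f < \<infinity>"
  shows "(\<lambda>k. energy P (\<lambda>n. truncate k f n - f n)) \<longlonglongrightarrow> 0"
proof -
  have "(\<lambda>k. \<integral>\<^sup>+n. ennreal (norm (truncate k f n - f n) ^ P) \<partial>int_counting)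
      \<longlonglongrightarrow> (\<integral>\<^sup>+n. 0 \<partial>int_counting)"
  proof (rule nn_integral_dominated_convergence[where w = "\<lambda>n. ennreal (norm (f n) ^ P)"])
    show "AE n in int_counting. ennreal (norm (truncate j f n - f n) ^ P) \<le> ennreal (norm (f n) ^ P)" for j
      by (intro AE_I2 ennreal_leI power_mono) (auto simp: truncate_def)
    have "(\<lambda>k. ennreal (norm (truncate k f n - f n) ^ P)) \<longlonglongrightarrow> 0" for n
      by (rule tendsto_eventually, rule eventually_mono[OF eventually_truncate_eq[of f n]])
         (use assms(1) in \<open>auto simp: zero_power\<close>)
    thus "AE n in int_counting. (\<lambda>k. ennreal (norm (truncate k f n - f n) ^ P)) \<longlonglongrightarrow> 0"
      by simp
  qed (use assms(2) in \<open>auto simp: energy_def\<close>)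
  thus ?thesis by (simp add: energy_def)
qed

lemma energy_truncate_le: "energy P (truncate k f) \<le> energy P f"
  unfolding energy_def by (intro nn_integral_mono ennreal_leI power_mono norm_truncate_le) auto

lemma lp_norm_1_finite_iff: "lp_norm 1 f < \<infinity> \<longleftrightarrow> integrable int_counting f" for f :: "int \<Rightarrow> complex"
  using Lp_norm_power[of 1 int_counting f] integrable_norm_iff[of f int_counting] by auto

section \<open>Fourier series of summable sequences\<close>

text \<open>Written as an integral over counting measure, the series becomes accessible to dominated
  convergence and to linearity of the integral.\<close>

lemma fourier_series_eq_integral:
  assumes "integrable int_counting f"
  shows "fourier_series f \<xi> = (\<integral>n. f n * cis (- 2 * pi * of_int n * \<xi>) \<partial>int_counting)"
proof -
  have "integrable int_counting (\<lambda>n. f n * cis (- 2 * pi * of_int n * \<xi>))"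
    by (rule Bochner_Integration.integrable_bound[OF assms]) (auto simp: norm_mult)
  hence "Infinite_Set_Sum.abs_summable_on (\<lambda>n. f n * cis (- 2 * pi * of_int n * \<xi>)) UNIV"
    by (simp add: Infinite_Set_Sum.abs_summable_on_def set_integrable_def)
  from infsetsum_infsum[OF this] show ?thesis
    by (simp add: fourier_series_def infsetsum_def)
qed

lemma norm_fourier_series_le:
  assumes "integrable int_counting f"
  shows "norm (fourier_series f \<xi>) \<le> (\<integral>n. norm (f n) \<partial>int_counting)"
  unfolding fourier_series_eq_integral[OF assms]
  using integral_norm_bound[of int_counting "\<lambda>n. f n * cis (- 2 * pi * of_int n * \<xi>)"]
  by (simp add: norm_mult)

lemma fourier_series_diff:
  assumes "integrable int_counting f" "integrable int_counting g"
  shows "fourier_series (\<lambda>n. f n - g n) \<xi> = fourier_series f \<xi> - fourier_series g \<xi>"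
proof -
  have "integrable int_counting (\<lambda>n. h n * cis (- 2 * pi * of_int n * \<xi>))"
    if "integrable int_counting h" for h
    by (rule Bochner_Integration.integrable_bound[OF that]) (auto simp: norm_mult)
  with assms show ?thesis
    by (simp add: fourier_series_eq_integral left_diff_distrib Bochner_Integration.integral_diff)
qed

lemma fourier_series_finite:
  assumes "finite A" "\<And>n. n \<notin> A \<Longrightarrow> f n = 0"
  shows "fourier_series f \<xi> = trig_sum A f \<xi>"
  unfolding fourier_series_def trig_sum_def using assms
  by (subst infsum_cong_neutral[where T = A and g = "\<lambda>n. f n * cis (- 2 * pi * of_int n * \<xi>)"]) auto

lemma fourier_series_truncate: "fourier_series (truncate k f) = trig_sum {- int k..int k} (truncate k f)"
  by (intro ext fourier_series_finite truncate_eq_0) auto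

lemma fourier_series_truncate_tendsto:
  assumes "integrable int_counting f"
  shows "(\<lambda>k. fourier_series (truncate k f) \<xi>) \<longlonglongrightarrow> fourier_series f \<xi>"
  unfolding fourier_series_eq_integral[OF assms] fourier_series_eq_integral[OF integrable_truncate]
proof (rule integral_dominated_convergence[where w = "\<lambda>n. norm (f n)"])
  show "AE n in int_counting. (\<lambda>k. truncate k f n * cis (- 2 * pi * of_int n * \<xi>))
      \<longlonglongrightarrow> f n * cis (- 2 * pi * of_int n * \<xi>)"
    by (intro AE_I2 tendsto_intros truncate_tendsto)
qed (use assms norm_truncate_le in \<open>auto simp: norm_mult\<close>)

lemma borel_measurable_fourier_series:
  assumes "integrable int_counting f"
  shows "fourier_series f \<in> borel_measurable borel"
  by (rule borel_measurable_LIMSEQ_metric[OF _ fourier_series_truncate_tendsto[OF assms]])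
     (simp add: fourier_series_truncate)

lemma cis_add_int: "cis (2 * pi * of_int n * (x + of_int l)) = cis (2 * pi * of_int n * x)"
proof -
  have "2 * pi * of_int n * (x + of_int l) = 2 * pi * of_int n * x + 2 * pi * of_int (n * l)"
    by (simp add: algebra_simps)
  thus ?thesis
    by (simp add: cis_mult[symmetric] cis_multiple_2pi del: of_int_mult)
qed

lemma fourier_series_add_int: "fourier_series f (\<xi> + of_int l) = fourier_series f \<xi>"
proof -
  have "cis (- 2 * pi * of_int n * (\<xi> + of_int l)) = cis (- 2 * pi * of_int n * \<xi>)" for n
    using cis_add_int[of "- n" \<xi> l] by simp
  thus ?thesis by (simp add: fourier_series_def)
qed

lemma AE_lebesgue_not_in_finite: "finite S \<Longrightarrow> AE x::real in lebesgue. x \<notin> S"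
  by (intro AE_completion AE_not_in countable_imp_null_set_lborel countable_finite)

text \<open>Undoes a periodization: after translation the three terms integrate \<open>g\<close>
  over \<open>{1..2}\<close>, \<open>{0..1}\<close> and \<open>{-1..0}\<close>.\<close>

lemma integral_lebesgue_unfold:
  fixes g :: "real \<Rightarrow> complex"
  assumes g: "integrable lebesgue g" and supp: "\<And>x. x \<notin> {-1..2} \<Longrightarrow> g x = 0"
  shows "(LINT x:{0..1}|lebesgue. (\<Sum>l\<in>{-1,0,1}. g (x - of_int l))) = (\<integral>x. g x \<partial>lebesgue)"
proof -
  let ?h = "\<lambda>l x. indicator {- of_int l..1 - of_int l} x *\<^sub>R g x :: complex"
  have gshift: "integrable lebesgue (\<lambda>x. g (x - of_int l))" for l :: int
    using lebesgue_integrable_real_affine[OF g, of 1 "- of_int l"] by simp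
  have ind: "integrable lebesgue (\<lambda>x. indicator {u..v} x *\<^sub>R f x)"
    if "integrable lebesgue f" for u v :: real and f :: "real \<Rightarrow> complex"
    by (rule integrable_mult_indicator[OF _ that]) simp
  have shift: "(\<integral>x. indicator {0..1} x *\<^sub>R g (x - of_int l) \<partial>lebesgue) = (\<integral>x. ?h l x \<partial>lebesgue)" for l :: int
  proof -
    have "(\<integral>x. indicator {0..1} x *\<^sub>R g (x - of_int l) \<partial>lebesgue)
        = (\<integral>x. indicator {0..1} (x + of_int l) *\<^sub>R g x \<partial>lebesgue)"
      by (subst lebesgue_integral_real_affine[of 1 _ "of_int l"]) (simp_all add: add.commute)
    also have "\<dots> = (\<integral>x. ?h l x \<partial>lebesgue)"
      by (intro Bochner_Integration.integral_cong refl) (auto simp: indicator_def)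
    finally show ?thesis .
  qed
  have "(LINT x:{0..1}|lebesgue. (\<Sum>l\<in>{-1,0,1}. g (x - of_int l)))
      = (\<integral>x. (\<Sum>l\<in>{-1,0,1::int}. indicator {0..1} x *\<^sub>R g (x - of_int l)) \<partial>lebesgue)"
    unfolding set_lebesgue_integral_def scaleR_sum_right ..
  also have "\<dots> = (\<Sum>l\<in>{-1,0,1::int}. \<integral>x. indicator {0..1} x *\<^sub>R g (x - of_int l) \<partial>lebesgue)"
    by (rule Bochner_Integration.integral_sum) (rule ind[OF gshift])
  also have "\<dots> = (\<Sum>l\<in>{-1,0,1::int}. \<integral>x. ?h l x \<partial>lebesgue)"
    unfolding shift ..
  also have "\<dots> = (\<integral>x. (\<Sum>l\<in>{-1,0,1::int}. ?h l x) \<partial>lebesgue)"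
    by (rule Bochner_Integration.integral_sum[symmetric]) (rule ind[OF g])
  also have "\<dots> = (\<integral>x. g x \<partial>lebesgue)"
  proof (rule integral_cong_AE)
    show "(\<lambda>x. \<Sum>l\<in>{-1,0,1::int}. ?h l x) \<in> borel_measurable lebesgue"
      by (intro borel_measurable_integrable Bochner_Integration.integrable_sum ind[OF g])
    show "g \<in> borel_measurable lebesgue"
      using g by simp
    \<comment> \<open>The common endpoints of the three intervals are counted twice.\<close>
    have "AE x::real in lebesgue. x \<notin> {0, 1}"
      by (rule AE_lebesgue_not_in_finite) simp
    thus "AE x in lebesgue. (\<Sum>l\<in>{-1,0,1::int}. ?h l x) = g x"
    proof eventually_elim
      case (elim x)
      thus ?case using supp[of x] by (auto simp: indicator_def)
    qed
  qed
  finally show ?thesis .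
qed

section \<open>A single frequency piece of a summable sequence\<close>

text \<open>The frequency \<open>\<theta> = 1\<close> occurs, as the only reduced fraction with
  denominator 1. With \<open>\<epsilon> < 1\<close> the dilated multiplier lives within 1/2 of
  \<open>\<theta>\<close>, so that only the shifts -1, 0 and 1 of it can meet the unit
  interval.\<close>

locale freq_projection =
  fixes m :: "real \<Rightarrow> complex" and \<epsilon> \<theta> M :: real
  assumes m_meas: "m \<in> borel_measurable lebesgue"
    and m_bound: "\<And>\<xi>. norm (m \<xi>) \<le> M"
    and m_supp: "\<And>\<xi>. 1 / 2 < \<bar>\<xi>\<bar> \<Longrightarrow> m \<xi> = 0"
    and eps: "0 < \<epsilon>" "\<epsilon> < 1"
    and theta: "0 \<le> \<theta>" "\<theta> \<le> 1"
begin

lemma M_nonneg: "0 \<le> M"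
  using order_trans[OF norm_ge_zero m_bound[of 0]] .

text \<open>A single bump of the periodic function in \<open>freq_piece_l1\<close>. Integrating it
  over the whole line replaces integrating the periodic function over one period.\<close>

definition density :: "(int \<Rightarrow> complex) \<Rightarrow> real \<Rightarrow> complex" where
  "density f \<xi> = m (inverse \<epsilon> * (\<xi> - \<theta>)) * fourier_series f \<xi>"

lemma density_supp: "\<epsilon> / 2 < \<bar>\<xi> - \<theta>\<bar> \<Longrightarrow> density f \<xi> = 0"
proof -
  assume "\<epsilon> / 2 < \<bar>\<xi> - \<theta>\<bar>"
  hence "1 / 2 < \<bar>inverse \<epsilon> * (\<xi> - \<theta>)\<bar>"
    using eps by (simp add: abs_mult field_simps)
  thus ?thesis by (simp add: density_def m_supp)
qed

text \<open>Lebesgue measurability survives composition with an affine map of nonzero slope, since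
  preimages of null sets are null.\<close>

lemma m_affine_meas: "(\<lambda>\<xi>. m (inverse \<epsilon> * (\<xi> - \<theta>))) \<in> borel_measurable lebesgue"
proof -
  have "(\<lambda>\<xi>. - inverse \<epsilon> * \<theta> + inverse \<epsilon> * \<xi>) \<in> lebesgue \<rightarrow>\<^sub>M lebesgue"
    using lebesgue_affine_measurable[where c = "\<lambda>_::real. inverse \<epsilon>" and t = "- inverse \<epsilon> * \<theta>"] eps by simp
  from measurable_compose[OF this m_meas] show ?thesis
    by (simp add: algebra_simps)
qed

lemma norm_density_le:
  "integrable int_counting f \<Longrightarrow> norm (density f \<xi>) \<le> M * (\<integral>n. norm (f n) \<partial>int_counting)"
  unfolding density_def norm_mult
  by (intro mult_mono m_bound norm_fourier_series_le M_nonneg) auto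

lemma integrable_density:
  assumes "integrable int_counting f"
  shows "integrable lebesgue (density f)"
proof (rule integrable_of_bounded_support)
  show "density f \<in> borel_measurable lebesgue"
    unfolding density_def
    by (intro borel_measurable_times m_affine_meas measurable_completion)
       (simp add: borel_measurable_fourier_series[OF assms])
  show "density f x = 0" if "x \<notin> {\<theta> - \<epsilon>..\<theta> + \<epsilon>}" for x
    using that eps by (intro density_supp) (auto simp: abs_if)
qed (rule norm_density_le[OF assms])

lemma integrable_density_cis:
  assumes "integrable int_counting f"
  shows "integrable lebesgue (\<lambda>\<xi>. density f \<xi> * cis (2 * pi * of_int n * \<xi>))"
proof (rule Bochner_Integration.integrable_bound[OF integrable_density[OF assms]])
  have "(\<lambda>\<xi>. cis (2 * pi * of_int n * \<xi>)) \<in> borel_measurable lebesgue"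
    by (rule measurable_completion) measurable
  thus "(\<lambda>\<xi>. density f \<xi> * cis (2 * pi * of_int n * \<xi>)) \<in> borel_measurable lebesgue"
    using integrable_density[OF assms] by (intro borel_measurable_times) auto
qed (simp add: norm_mult)

text \<open>The Fourier series and the integer characters have period 1, so each shift of the
  multiplier is a shift of the whole integrand, and the sum unfolds.\<close>

lemma freq_piece_l1_eq:
  assumes f: "integrable int_counting f"
  shows "freq_piece_l1 m \<epsilon> \<theta> f n = (\<integral>\<xi>. density f \<xi> * cis (2 * pi * of_int n * \<xi>) \<partial>lebesgue)"
proof -
  define g where "g \<xi> = density f \<xi> * cis (2 * pi * of_int n * \<xi>)" for \<xi>
  have g: "integrable lebesgue g"
    unfolding g_def by (rule integrable_density_cis[OF f])
  have inner: "(\<Sum>\<^sub>\<infinity>l::int. m (inverse \<epsilon> * (\<xi> - of_int l - \<theta>)) * fourier_series f \<xi>)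
      * cis (2 * pi * of_int n * \<xi>) = (\<Sum>l\<in>{-1,0,1}. g (\<xi> - of_int l))"
    if "\<xi> \<in> {0..1}" for \<xi>
  proof -
    have "m (inverse \<epsilon> * (\<xi> - of_int l - \<theta>)) = 0" if "l \<notin> {-1,0,1}" for l :: int
    proof -
      \<comment> \<open>Since \<open>\<xi>\<close> and \<open>\<theta>\<close> both lie in
        \<open>{0..1}\<close>, the argument has absolute value at least 1, which exceeds
        \<open>\<epsilon> / 2\<close>.\<close>
      have "2 \<le> \<bar>l\<bar>" using that by auto
      hence "2 \<le> \<bar>real_of_int l\<bar>" by linarith
      hence "\<epsilon> / 2 < \<bar>\<xi> - of_int l - \<theta>\<bar>"
        using \<open>\<xi> \<in> {0..1}\<close> theta eps by (auto simp: abs_if split: if_splits)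
      hence "1 / 2 < \<bar>inverse \<epsilon> * (\<xi> - of_int l - \<theta>)\<bar>"
        using eps by (simp add: abs_mult field_simps)
      thus ?thesis by (rule m_supp)
    qed
    hence "(\<Sum>\<^sub>\<infinity>l::int. m (inverse \<epsilon> * (\<xi> - of_int l - \<theta>)) * fourier_series f \<xi>)
        = (\<Sum>\<^sub>\<infinity>l\<in>{-1,0,1::int}. m (inverse \<epsilon> * (\<xi> - of_int l - \<theta>)) * fourier_series f \<xi>)"
      by (intro infsum_cong_neutral) auto
    also have "\<dots> * cis (2 * pi * of_int n * \<xi>) = (\<Sum>l\<in>{-1,0,1::int}.
        m (inverse \<epsilon> * (\<xi> - of_int l - \<theta>)) * fourier_series f \<xi> * cis (2 * pi * of_int n * \<xi>))"
      by (simp add: algebra_simps)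
    also have "\<dots> = (\<Sum>l\<in>{-1,0,1}. g (\<xi> - of_int l))"
    proof (rule sum.cong)
      fix l :: int
      show "m (inverse \<epsilon> * (\<xi> - of_int l - \<theta>)) * fourier_series f \<xi> * cis (2 * pi * of_int n * \<xi>)
          = g (\<xi> - of_int l)"
        using fourier_series_add_int[of f \<xi> "- l"] cis_add_int[of n \<xi> "- l"]
        by (simp add: g_def density_def)
    qed simp
    finally show ?thesis .
  qed
  have "freq_piece_l1 m \<epsilon> \<theta> f n = (LINT \<xi>:{0..1}|lebesgue. (\<Sum>l\<in>{-1,0,1}. g (\<xi> - of_int l)))"
    unfolding freq_piece_l1_def
    by (rule set_lebesgue_integral_cong) (use inner in auto)
  also have "\<dots> = (\<integral>\<xi>. g \<xi> \<partial>lebesgue)"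
  proof (rule integral_lebesgue_unfold[OF g])
    fix x :: real assume "x \<notin> {-1..2}"
    hence "\<epsilon> / 2 < \<bar>x - \<theta>\<bar>" using theta eps by auto
    thus "g x = 0" by (simp add: g_def density_supp)
  qed
  finally show ?thesis by (simp add: g_def)
qed

lemma freq_piece_l1_diff:
  assumes "integrable int_counting f" "integrable int_counting g"
  shows "freq_piece_l1 m \<epsilon> \<theta> (\<lambda>n. f n - g n) n = freq_piece_l1 m \<epsilon> \<theta> f n - freq_piece_l1 m \<epsilon> \<theta> g n"
proof -
  have "density (\<lambda>n. f n - g n) \<xi> = density f \<xi> - density g \<xi>" for \<xi>
    by (simp add: density_def fourier_series_diff[OF assms] right_diff_distrib)
  thus ?thesis
    using assms by (simp add: freq_piece_l1_eq left_diff_distrib integrable_density_cis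
        Bochner_Integration.integral_diff)
qed

text \<open>The densities of all truncations live on one bounded interval and are bounded by
  \<open>M\<close> times the sum of \<open>norm (f n)\<close>, so dominated convergence
  applies.\<close>

lemma freq_piece_l1_truncate_tendsto:
  assumes f: "integrable int_counting f"
  shows "(\<lambda>k. freq_piece_l1 m \<epsilon> \<theta> (truncate k f) n) \<longlonglongrightarrow> freq_piece_l1 m \<epsilon> \<theta> f n"
  unfolding freq_piece_l1_eq[OF f] freq_piece_l1_eq[OF integrable_truncate]
proof (rule integral_dominated_convergence
    [where w = "\<lambda>\<xi>. M * (\<integral>n. norm (f n) \<partial>int_counting) * indicator {\<theta> - \<epsilon>..\<theta> + \<epsilon>} \<xi>"])
  show "integrable lebesgue (\<lambda>\<xi>. M * (\<integral>n. norm (f n) \<partial>int_counting) * indicator {\<theta> - \<epsilon>..\<theta> + \<epsilon>} \<xi>)"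
    by (intro integrable_mult_right integrable_real_indicator)
       (auto simp: emeasure_completion emeasure_lborel_Icc_eq)
  show "AE \<xi> in lebesgue. (\<lambda>k. density (truncate k f) \<xi> * cis (2 * pi * of_int n * \<xi>))
      \<longlonglongrightarrow> density f \<xi> * cis (2 * pi * of_int n * \<xi>)"
    unfolding density_def by (intro AE_I2 tendsto_intros fourier_series_truncate_tendsto f)
  show "AE \<xi> in lebesgue. norm (density (truncate k f) \<xi> * cis (2 * pi * of_int n * \<xi>))
      \<le> M * (\<integral>n. norm (f n) \<partial>int_counting) * indicator {\<theta> - \<epsilon>..\<theta> + \<epsilon>} \<xi>" for k
  proof (rule AE_I2)
    fix \<xi> :: real
    have "norm (density (truncate k f) \<xi>) \<le> M * (\<integral>n. norm (truncate k f n) \<partial>int_counting)"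
      by (rule norm_density_le[OF integrable_truncate])
    also have "\<dots> \<le> M * (\<integral>n. norm (f n) \<partial>int_counting)"
      using f integrable_truncate norm_truncate_le M_nonneg
      by (intro mult_left_mono integral_mono) auto
    finally have "norm (density (truncate k f) \<xi>) \<le> M * (\<integral>n. norm (f n) \<partial>int_counting)" .
    moreover have "density (truncate k f) \<xi> = 0" if "\<xi> \<notin> {\<theta> - \<epsilon>..\<theta> + \<epsilon>}"
      using that eps by (intro density_supp) (auto simp: abs_if)
    ultimately show "norm (density (truncate k f) \<xi> * cis (2 * pi * of_int n * \<xi>))
      \<le> M * (\<integral>n. norm (f n) \<partial>int_counting) * indicator {\<theta> - \<epsilon>..\<theta> + \<epsilon>} \<xi>"
      by (cases "\<xi> \<in> {\<theta> - \<epsilon>..\<theta> + \<epsilon>}") (auto simp: norm_mult)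
  qed
qed (use integrable_density_cis[OF f] integrable_density_cis[OF integrable_truncate] in auto)

text \<open>The substitution \<open>\<xi> = \<theta> + \<epsilon> * \<eta>\<close> brings a piece
  into the form treated by \<open>transference\<close>: the modulation of \<open>f\<close> moves
  \<open>\<theta>\<close> to the origin, and the integer \<open>n\<close> becomes the sampling point
  \<open>\<epsilon> * of_int n\<close>.\<close>

lemma freq_piece_l1_finite:
  assumes A: "finite A" and f: "\<And>n. n \<notin> A \<Longrightarrow> f n = 0" and int: "integrable int_counting f"
  shows "freq_piece_l1 m \<epsilon> \<theta> f n = \<epsilon> * cis (2 * pi * of_int n * \<theta>) *
    inv_fourier (\<lambda>\<eta>. m \<eta> * trig_sum A (\<lambda>k. f k * cis (- 2 * pi * of_int k * \<theta>)) (\<epsilon> * \<eta>)) (\<epsilon> * of_int n)"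
proof -
  let ?b = "\<lambda>k. f k * cis (- 2 * pi * of_int k * \<theta>)"
  have fs: "fourier_series f (\<theta> + \<epsilon> * \<eta>) = trig_sum A ?b (\<epsilon> * \<eta>)" for \<eta>
  proof -
    have "fourier_series f (\<theta> + \<epsilon> * \<eta>) = trig_sum A f (\<theta> + \<epsilon> * \<eta>)"
      by (rule fourier_series_finite[OF A f])
    also have "\<dots> = trig_sum A ?b (\<epsilon> * \<eta>)"
      unfolding trig_sum_def by (intro sum.cong refl) (simp add: cis_mult algebra_simps)
    finally show ?thesis .
  qed
  have "freq_piece_l1 m \<epsilon> \<theta> f n = (\<integral>\<xi>. density f \<xi> * cis (2 * pi * of_int n * \<xi>) \<partial>lebesgue)"
    by (rule freq_piece_l1_eq[OF int])
  also have "\<dots> = \<bar>\<epsilon>\<bar> *\<^sub>R (\<integral>\<eta>. density f (\<theta> + \<epsilon> * \<eta>) * cis (2 * pi * of_int n * (\<theta> + \<epsilon> * \<eta>)) \<partial>lebesgue)"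
    using eps by (intro lebesgue_integral_real_affine) auto
  also have "(\<lambda>\<eta>. density f (\<theta> + \<epsilon> * \<eta>) * cis (2 * pi * of_int n * (\<theta> + \<epsilon> * \<eta>)))
      = (\<lambda>\<eta>. cis (2 * pi * of_int n * \<theta>) *
          (m \<eta> * trig_sum A ?b (\<epsilon> * \<eta>) * cis (2 * pi * (\<epsilon> * of_int n) * \<eta>)))"
  proof
    fix \<eta>
    have "cis (2 * pi * of_int n * (\<theta> + \<epsilon> * \<eta>))
        = cis (2 * pi * of_int n * \<theta>) * cis (2 * pi * (\<epsilon> * of_int n) * \<eta>)"
      by (simp add: cis_mult algebra_simps)
    thus "density f (\<theta> + \<epsilon> * \<eta>) * cis (2 * pi * of_int n * (\<theta> + \<epsilon> * \<eta>))
      = cis (2 * pi * of_int n * \<theta>) *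
          (m \<eta> * trig_sum A ?b (\<epsilon> * \<eta>) * cis (2 * pi * (\<epsilon> * of_int n) * \<eta>))"
      using eps by (simp add: density_def fs mult.assoc[symmetric])
  qed
  finally show ?thesis
    using eps by (simp add: inv_fourier_def scaleR_conv_of_real mult.assoc)
qed

text \<open>Transference speaks of finitely supported inputs and finite windows of the output. The
  factor \<open>\<epsilon> ^ P\<close> in \<open>K'\<close> stems from the change of
  variables.\<close>

lemma freq_piece_l1_energy_bound:
  assumes P: "1 \<le> P" and mult: "Lp_multiplier (real P) m"
  obtains K :: real where "0 \<le> K"
    "\<And>f. integrable int_counting f \<Longrightarrow> energy P (freq_piece_l1 m \<epsilon> \<theta> f) \<le> ennreal K * energy P f"
proof -
  obtain K where K: "0 \<le> K" "\<And>A b N. finite A \<Longrightarrow> finite N \<Longrightarrow>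
    (\<Sum>n\<in>N. norm (inv_fourier (\<lambda>\<eta>. m \<eta> * trig_sum A b (\<epsilon> * \<eta>)) (\<epsilon> * of_int n)) ^ P)
      \<le> K * (\<Sum>k\<in>A. norm (b k) ^ P)"
    using transference[OF P mult m_supp eps(1)] by blast
  define K' where "K' = \<epsilon> ^ P * K"
  have "0 \<le> K'" using K(1) eps by (simp add: K'_def)
  have finite_bound: "energy P (truncate k (freq_piece_l1 m \<epsilon> \<theta> (truncate j f))) \<le> ennreal K' * energy P f" for j k f
  proof -
    let ?J = "{- int j..int j}" and ?N = "{- int k..int k}"
    have en: "energy P (truncate i h) = ennreal (\<Sum>n\<in>{- int i..int i}. norm (h n) ^ P)" for i h
    proof -
      have "energy P (truncate i h) = (\<Sum>n\<in>{- int i..int i}. ennreal (norm (truncate i h n) ^ P))"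
        unfolding energy_def using P
        by (intro nn_integral_count_space') (auto simp: truncate_eq_0 zero_power)
      also have "\<dots> = (\<Sum>n\<in>{- int i..int i}. ennreal (norm (h n) ^ P))"
        by (intro sum.cong) (auto simp: truncate_def)
      finally show ?thesis by (simp add: sum_ennreal)
    qed
    have "(\<Sum>n\<in>?N. norm (freq_piece_l1 m \<epsilon> \<theta> (truncate j f) n) ^ P) = \<epsilon> ^ P * (\<Sum>n\<in>?N.
        norm (inv_fourier (\<lambda>\<eta>. m \<eta> * trig_sum ?J (\<lambda>k. truncate j f k * cis (- 2 * pi * of_int k * \<theta>)) (\<epsilon> * \<eta>))
          (\<epsilon> * of_int n)) ^ P)"
      using eps
      by (subst freq_piece_l1_finite[where A = ?J])
         (auto simp: truncate_eq_0 integrable_truncate norm_mult power_mult_distrib sum_distrib_left)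
    also have "\<dots> \<le> \<epsilon> ^ P * (K * (\<Sum>k\<in>?J. norm (truncate j f k * cis (- 2 * pi * of_int k * \<theta>)) ^ P))"
      using eps by (intro mult_left_mono K) auto
    also have "\<dots> = K' * (\<Sum>k\<in>?J. norm (f k) ^ P)"
    proof -
      have "(\<Sum>k\<in>?J. norm (truncate j f k * cis (- 2 * pi * of_int k * \<theta>)) ^ P) = (\<Sum>k\<in>?J. norm (f k) ^ P)"
        by (intro sum.cong) (auto simp: norm_mult truncate_def)
      thus ?thesis by (simp add: K'_def)
    qed
    finally have "energy P (truncate k (freq_piece_l1 m \<epsilon> \<theta> (truncate j f))) \<le> ennreal K' * energy P (truncate j f)"
      unfolding en using \<open>0 \<le> K'\<close> by (subst ennreal_mult'[symmetric]) (auto intro!: ennreal_leI)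
    also have "\<dots> \<le> ennreal K' * energy P f"
      by (intro mult_left_mono energy_truncate_le) auto
    finally show ?thesis .
  qed
  \<comment> \<open>Fatou's lemma is used twice: the outer application removes the truncation of
    \<open>f\<close>, the inner one the window on the output.\<close>
  have "energy P (freq_piece_l1 m \<epsilon> \<theta> f) \<le> ennreal K' * energy P f" if f: "integrable int_counting f" for f
  proof (rule energy_fatou[OF freq_piece_l1_truncate_tendsto[OF f]])
    fix j
    show "energy P (freq_piece_l1 m \<epsilon> \<theta> (truncate j f)) \<le> ennreal K' * energy P f"
      by (rule energy_fatou[OF truncate_tendsto finite_bound])
  qed
  with \<open>0 \<le> K'\<close> show thesis using that by blast
qed

end

section \<open>Extension by density\<close>

lemma ennreal_tendsto_0_mult_add:
  fixes a b :: "nat \<Rightarrow> ennreal"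
  assumes "a \<longlonglongrightarrow> 0" "b \<longlonglongrightarrow> 0" "c < \<infinity>" "\<And>k. u k \<le> c * (a k + b k)"
  shows "u \<longlonglongrightarrow> 0"
proof -
  have "(\<lambda>k. c * (a k + b k)) \<longlonglongrightarrow> c * (0 + 0)"
    using assms(3) by (intro ennreal_tendsto_cmult tendsto_add assms) auto
  hence "(\<lambda>k. c * (a k + b k)) \<longlonglongrightarrow> 0" by simp
  from tendsto_sandwich[OF _ _ tendsto_const this] show ?thesis
    using assms(4) by (simp add: always_eventually)
qed

text \<open>Justifies the definite description. The limit is constructed pointwise along
  truncations, and Fatou's lemma upgrades it to a limit in energy, so that completeness of the
  sequence space is not invoked.\<close>

lemma lp_extension_eqI:
  fixes T :: "(int \<Rightarrow> complex) \<Rightarrow> int \<Rightarrow> complex"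
  assumes P: "1 \<le> P"
    and diff: "\<And>f g n. integrable int_counting f \<Longrightarrow> integrable int_counting g \<Longrightarrow>
      T (\<lambda>n. f n - g n) n = T f n - T g n"
    and K: "0 \<le> K" "\<And>f. integrable int_counting f \<Longrightarrow> energy P (T f) \<le> ennreal K * energy P f"
    and f: "energy P f < \<infinity>"
  shows "energy P (lp_extension (real P) T f) < \<infinity>"
    and "(\<lambda>k. energy P (\<lambda>n. T (truncate k f) n - lp_extension (real P) T f n)) \<longlonglongrightarrow> 0"
proof -
  let ?e = "\<lambda>k. energy P (\<lambda>n. truncate k f n - f n)"
  define c where "c = ennreal K * 2 ^ P"
  have "c < \<infinity>"
    by (simp add: c_def ennreal_mult_less_top ennreal_power flip: ennreal_numeral)
  have e0: "?e \<longlonglongrightarrow> 0"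
    by (rule energy_truncate_tendsto[OF P f])
  \<comment> \<open>Measuring both sequences by their distance to \<open>f\<close> makes one
    estimate serve the Cauchy property, the limit in energy and the independence of the
    approximating sequence.\<close>
  have Tdiff: "energy P (\<lambda>n. T u n - T v n) \<le> c * (energy P (\<lambda>n. u n - f n) + energy P (\<lambda>n. v n - f n))"
    if "integrable int_counting u" "integrable int_counting v" for u v
  proof -
    have "energy P (\<lambda>n. T u n - T v n) = energy P (T (\<lambda>n. u n - v n))"
      using diff[OF that] by (simp add: energy_def)
    also have "\<dots> \<le> ennreal K * energy P (\<lambda>n. u n - v n)"
      using that by (intro K) auto
    also have "\<dots> \<le> ennreal K * (2 ^ P * (energy P (\<lambda>n. u n - f n) + energy P (\<lambda>n. f n - v n)))"
      by (intro mult_left_mono energy_triangle) auto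
    finally show ?thesis
      by (simp add: c_def mult.assoc energy_minus_commute[of P f])
  qed
  have "Cauchy (\<lambda>k. T (truncate k f) n)" for n
  proof (rule metric_CauchyI)
    fix \<delta> :: real assume "0 < \<delta>"
    have "(\<lambda>k. c * (?e k + ?e k)) \<longlonglongrightarrow> 0"
      by (rule ennreal_tendsto_0_mult_add[OF e0 e0 \<open>c < \<infinity>\<close>]) simp
    hence "eventually (\<lambda>k. c * (?e k + ?e k) < ennreal (\<delta> ^ P)) sequentially"
      using \<open>0 < \<delta>\<close> by (intro order_tendstoD(2)) (auto simp: ennreal_less_zero_iff)
    then obtain N where N: "c * (?e N + ?e N) < ennreal (\<delta> ^ P)"
      by (auto simp: eventually_sequentially)
    show "\<exists>N. \<forall>i\<ge>N. \<forall>j\<ge>N. dist (T (truncate i f) n) (T (truncate j f) n) < \<delta>"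
    proof (intro exI allI impI)
      fix i j assume "N \<le> i" "N \<le> j"
      have "ennreal (norm (T (truncate i f) n - T (truncate j f) n) ^ P)
          \<le> energy P (\<lambda>n. T (truncate i f) n - T (truncate j f) n)"
        by (rule power_norm_le_energy)
      also have "\<dots> \<le> c * (?e i + ?e j)"
        by (intro Tdiff integrable_truncate)
      also have "\<dots> \<le> c * (?e N + ?e N)"
        using \<open>N \<le> i\<close> \<open>N \<le> j\<close> by (intro mult_left_mono add_mono energy_truncate_antimono) auto
      also note N
      finally have "norm (T (truncate i f) n - T (truncate j f) n) ^ P < \<delta> ^ P"
        by (simp add: ennreal_less_iff)
      thus "dist (T (truncate i f) n) (T (truncate j f) n) < \<delta>"
        using \<open>0 < \<delta>\<close> by (simp add: dist_norm power_less_imp_less_base)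
    qed
  qed
  hence "\<exists>g. \<forall>n. (\<lambda>k. T (truncate k f) n) \<longlonglongrightarrow> g n"
    by (intro choice allI) (simp add: Cauchy_convergent_iff convergent_def)
  then obtain g where g: "\<And>n. (\<lambda>k. T (truncate k f) n) \<longlonglongrightarrow> g n"
    by blast
  \<comment> \<open>The index \<open>j + k\<close> never falls below \<open>k\<close>, so both
    errors are at most \<open>?e k\<close> while \<open>j\<close> tends to infinity.\<close>
  have Tg_le: "energy P (\<lambda>n. T (truncate k f) n - g n) \<le> c * (?e k + ?e k)" for k
  proof (rule energy_fatou)
    show "(\<lambda>j. T (truncate k f) n - T (truncate (j + k) f) n) \<longlonglongrightarrow> T (truncate k f) n - g n" for n
      by (intro tendsto_diff tendsto_const LIMSEQ_ignore_initial_segment g)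
    show "energy P (\<lambda>n. T (truncate k f) n - T (truncate (j + k) f) n) \<le> c * (?e k + ?e k)" for j
      by (rule order_trans[OF Tdiff[OF integrable_truncate integrable_truncate]])
         (intro mult_left_mono add_mono energy_truncate_antimono; simp)
  qed
  have Tg: "(\<lambda>k. energy P (\<lambda>n. T (truncate k f) n - g n)) \<longlonglongrightarrow> 0"
    by (rule ennreal_tendsto_0_mult_add[OF e0 e0 \<open>c < \<infinity>\<close> Tg_le])
  have g_fin: "energy P g < \<infinity>"
  proof -
    have "eventually (\<lambda>k. energy P (\<lambda>n. T (truncate k f) n - g n) < 1) sequentially"
      by (rule order_tendstoD(2)[OF Tg]) simp
    then obtain k where k: "energy P (\<lambda>n. T (truncate k f) n - g n) < 1"
      by (auto simp: eventually_sequentially)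
    have "energy P g \<le> 2 ^ P * (energy P (\<lambda>n. g n - T (truncate k f) n) + energy P (T (truncate k f)))"
      using energy_add_le[of P "\<lambda>n. g n - T (truncate k f) n" "T (truncate k f)"] by simp
    also have "\<dots> \<le> 2 ^ P * (1 + ennreal K * energy P f)"
      using k K(2)[OF integrable_truncate, of k f] energy_truncate_le[of P k f]
      by (intro mult_left_mono add_mono)
         (auto simp: energy_minus_commute[of P g] intro: order_trans[OF _ mult_left_mono])
    also have "\<dots> < \<infinity>"
      using f by (simp add: ennreal_mult_less_top ennreal_power flip: ennreal_numeral)
    finally show ?thesis .
  qed
  let ?Q = "\<lambda>g. lp_norm (real P) g < \<infinity> \<and> (\<forall>\<phi>::nat \<Rightarrow> int \<Rightarrow> complex.
      (\<forall>k. lp_norm 1 (\<phi> k) < \<infinity>) \<and> (\<lambda>k. lp_norm (real P) (\<lambda>n. \<phi> k n - f n)) \<longlonglongrightarrow> 0 \<longrightarrow>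
      (\<lambda>k. lp_norm (real P) (\<lambda>n. T (\<phi> k) n - g n)) \<longlonglongrightarrow> 0)"
  have "lp_extension (real P) T f = g"
    unfolding lp_extension_def
  proof (rule the_equality)
    show "?Q g"
      unfolding lp_norm_tendsto_0_iff_energy[OF P] lp_norm_finite_iff_energy[OF P] lp_norm_1_finite_iff
    proof (intro conjI allI impI g_fin; elim conjE)
      fix \<phi> :: "nat \<Rightarrow> int \<Rightarrow> complex"
      assume \<phi>: "\<forall>k. integrable int_counting (\<phi> k)" and lim: "(\<lambda>k. energy P (\<lambda>n. \<phi> k n - f n)) \<longlonglongrightarrow> 0"
      have "(\<lambda>k. energy P (\<lambda>n. T (\<phi> k) n - T (truncate k f) n)) \<longlonglongrightarrow> 0"
        by (rule ennreal_tendsto_0_mult_add[OF lim e0 \<open>c < \<infinity>\<close>])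
           (intro Tdiff integrable_truncate \<phi>[rule_format])
      from ennreal_tendsto_0_mult_add[OF this Tg _ energy_triangle]
      show "(\<lambda>k. energy P (\<lambda>n. T (\<phi> k) n - g n)) \<longlonglongrightarrow> 0"
        by (simp add: ennreal_power flip: ennreal_numeral)
    qed
    \<comment> \<open>For uniqueness the truncations serve as the test sequence: a limit in energy
      determines every single value.\<close>
    fix h assume h: "?Q h"
    have "(\<lambda>k. energy P (\<lambda>n. T (truncate k f) n - h n)) \<longlonglongrightarrow> 0"
      using h[THEN conjunct2, THEN spec[of _ "\<lambda>k. truncate k f"]] e0 integrable_truncate
      unfolding lp_norm_tendsto_0_iff_energy[OF P] lp_norm_1_finite_iff
      by simp
    hence "(\<lambda>k. T (truncate k f) n) \<longlonglongrightarrow> h n" for n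
      by (rule energy_tendsto_0_pointwise[OF P])
    thus "h = g"
      using g LIMSEQ_unique by (intro ext) blast
  qed
  with g_fin Tg show "energy P (lp_extension (real P) T f) < \<infinity>"
    and "(\<lambda>k. energy P (\<lambda>n. T (truncate k f) n - lp_extension (real P) T f n)) \<longlonglongrightarrow> 0"
    by simp_all
qed

lemma (in freq_projection)
  assumes "1 \<le> P" "Lp_multiplier (real P) m" "energy P f < \<infinity>"
  shows energy_freq_piece_finite: "energy P (freq_piece (real P) m \<epsilon> \<theta> f) < \<infinity>"
    and freq_piece_truncate_tendsto:
      "(\<lambda>k. energy P (\<lambda>n. freq_piece_l1 m \<epsilon> \<theta> (truncate k f) n - freq_piece (real P) m \<epsilon> \<theta> f n)) \<longlonglongrightarrow> 0"
    and energy_freq_piece_l1_truncate_finite: "energy P (freq_piece_l1 m \<epsilon> \<theta> (truncate k f)) < \<infinity>"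
proof -
  obtain K where K: "0 \<le> K"
    "\<And>f. integrable int_counting f \<Longrightarrow> energy P (freq_piece_l1 m \<epsilon> \<theta> f) \<le> ennreal K * energy P f"
    using freq_piece_l1_energy_bound[OF assms(1,2)] by blast
  show "energy P (freq_piece (real P) m \<epsilon> \<theta> f) < \<infinity>"
    and "(\<lambda>k. energy P (\<lambda>n. freq_piece_l1 m \<epsilon> \<theta> (truncate k f) n - freq_piece (real P) m \<epsilon> \<theta> f n)) \<longlonglongrightarrow> 0"
    unfolding freq_piece_def
    by (rule lp_extension_eqI[OF assms(1) freq_piece_l1_diff K assms(3)]; assumption)+
  have "energy P (freq_piece_l1 m \<epsilon> \<theta> (truncate k f)) \<le> ennreal K * energy P f"
    using K(2)[OF integrable_truncate] energy_truncate_le by (rule order_trans[OF _ mult_left_mono]) auto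
  also have "\<dots> < \<infinity>"
    using assms(3) by (simp add: ennreal_mult_less_top)
  finally show "energy P (freq_piece_l1 m \<epsilon> \<theta> (truncate k f)) < \<infinity>" .
qed

section \<open>Spectral orthogonality\<close>

text \<open>A dual form of the statement that \<open>h\<close> has spectrum in $[c - \rho, c + \rho]$: finite sums
  against \<open>h\<close> are controlled by the same sums against the characters from that interval.
  Unlike a spectral measure, this can be propagated through products one factor at a time.\<close>
definition spectral_bound :: "real \<Rightarrow> real \<Rightarrow> real \<Rightarrow> (int \<Rightarrow> complex) \<Rightarrow> bool" where
  "spectral_bound c \<rho> B h \<longleftrightarrow> (\<forall>(I :: (nat \<times> int) set) w s. finite I \<longrightarrow>
     (\<forall>\<xi>. \<bar>\<xi> - c\<bar> \<le> \<rho> \<longrightarrow> norm (\<Sum>i\<in>I. w i * cis (2 * pi * of_int (snd i) * \<xi>)) \<le> s) \<longrightarrow>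
     norm (\<Sum>i\<in>I. w i * h (snd i)) \<le> B * s)"

lemma spectral_bound_one: "spectral_bound 0 0 1 (\<lambda>_. 1)"
  unfolding spectral_bound_def
proof (intro allI impI)
  fix I :: "(nat \<times> int) set" and w s
  assume "\<forall>\<xi>. \<bar>\<xi> - 0\<bar> \<le> 0 \<longrightarrow> norm (\<Sum>i\<in>I. w i * cis (2 * pi * of_int (snd i) * \<xi>)) \<le> s"
  from this[rule_format, of 0] show "norm (\<Sum>i\<in>I. w i * 1) \<le> 1 * s" by simp
qed

text \<open>For fixed \<open>x\<close> the character at \<open>\<tau> x\<close> is absorbed into the
  coefficients, and the hypothesis on \<open>h\<close> is applied to the modulated coefficients;
  integration against the norm of \<open>\<mu>\<close> finishes. The map \<open>\<tau>\<close> is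
  the identity for a piece and the reflection for its conjugate.\<close>

lemma spectral_bound_mult:
  fixes \<mu> :: "real \<Rightarrow> complex"
  assumes h: "spectral_bound c \<rho> B h" and \<mu>: "integrable lebesgue \<mu>"
    and int: "\<And>n. integrable lebesgue (\<lambda>x. \<mu> x * cis (2 * pi * of_int n * \<tau> x))"
    and u: "\<And>n. u n = (\<integral>x. \<mu> x * cis (2 * pi * of_int n * \<tau> x) \<partial>lebesgue)"
    and supp: "\<And>x. \<mu> x \<noteq> 0 \<Longrightarrow> \<bar>\<tau> x - d\<bar> \<le> \<sigma>"
  shows "spectral_bound (c + d) (\<rho> + \<sigma>) (B * (\<integral>x. norm (\<mu> x) \<partial>lebesgue)) (\<lambda>n. h n * u n)"
  unfolding spectral_bound_def
proof (intro allI impI)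
  fix I :: "(nat \<times> int) set" and w s
  assume I: "finite I"
    and s: "\<forall>\<xi>. \<bar>\<xi> - (c + d)\<bar> \<le> \<rho> + \<sigma> \<longrightarrow> norm (\<Sum>i\<in>I. w i * cis (2 * pi * of_int (snd i) * \<xi>)) \<le> s"
  define F where "F x = (\<Sum>i\<in>I. w i * h (snd i) * (\<mu> x * cis (2 * pi * of_int (snd i) * \<tau> x)))" for x
  have "(\<Sum>i\<in>I. w i * (h (snd i) * u (snd i))) = (\<integral>x. F x \<partial>lebesgue)"
    unfolding F_def u
  proof (subst Bochner_Integration.integral_sum)
    show "integrable lebesgue (\<lambda>x. w i * h (snd i) * (\<mu> x * cis (2 * pi * of_int (snd i) * \<tau> x)))" for i
      by (intro integrable_mult_right int)
  qed (simp add: mult.assoc)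
  also have "norm \<dots> \<le> (\<integral>x. norm (F x) \<partial>lebesgue)"
    by (rule integral_norm_bound)
  also have "\<dots> \<le> (\<integral>x. (B * s) * norm (\<mu> x) \<partial>lebesgue)"
  proof (rule integral_mono)
    show "integrable lebesgue (\<lambda>x. norm (F x))"
      unfolding F_def by (intro integrable_norm Bochner_Integration.integrable_sum integrable_mult_right int)
    show "integrable lebesgue (\<lambda>x. B * s * norm (\<mu> x))"
      using \<mu> by simp
    fix x
    show "norm (F x) \<le> B * s * norm (\<mu> x)"
    proof (cases "\<mu> x = 0")
      case False
      have "norm (\<Sum>i\<in>I. w i * cis (2 * pi * of_int (snd i) * \<tau> x) * h (snd i)) \<le> B * s"
        using h[unfolded spectral_bound_def] I
      proof (elim allE impE)
        show "\<forall>\<xi>. \<bar>\<xi> - c\<bar> \<le> \<rho> \<longrightarrow> norm (\<Sum>i\<in>I. w i * cis (2 * pi * of_int (snd i) * \<tau> x)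
            * cis (2 * pi * of_int (snd i) * \<xi>)) \<le> s"
        proof (intro allI impI)
          fix \<xi> assume "\<bar>\<xi> - c\<bar> \<le> \<rho>"
          hence "\<bar>(\<tau> x + \<xi>) - (c + d)\<bar> \<le> \<rho> + \<sigma>"
            using supp[OF False] by linarith
          from s[rule_format, OF this]
          show "norm (\<Sum>i\<in>I. w i * cis (2 * pi * of_int (snd i) * \<tau> x)
            * cis (2 * pi * of_int (snd i) * \<xi>)) \<le> s"
            by (simp add: mult.assoc cis_mult distrib_left)
        qed
      qed
      moreover have "F x = \<mu> x * (\<Sum>i\<in>I. w i * cis (2 * pi * of_int (snd i) * \<tau> x) * h (snd i))"
        unfolding F_def sum_distrib_left by (simp add: mult_ac)
      ultimately show ?thesis
        by (simp add: norm_mult mult.commute[of "norm (\<mu> x)"] mult_right_mono)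
    qed (simp add: F_def)
  qed
  finally show "norm (\<Sum>i\<in>I. w i * (h (snd i) * u (snd i))) \<le> B * (\<integral>x. norm (\<mu> x) \<partial>lebesgue) * s"
    by (simp add: mult_ac)
qed

section \<open>Fejer sums away from the integers\<close>

lemma dirichlet_sum:
  "(cis (2 * pi * \<xi>) - 1) * (\<Sum>n\<in>{- int j..int j}. cis (2 * pi * of_int n * \<xi>))
     = cis (2 * pi * (real j + 1) * \<xi>) - cis (- 2 * pi * real j * \<xi>)"
proof (induction j)
  case (Suc j)
  let ?z = "cis (2 * pi * \<xi>)"
  have set: "{- int (Suc j)..int (Suc j)} = insert (int (Suc j)) (insert (- int (Suc j)) {- int j..int j})"
    by auto
  have "?z * cis (2 * pi * of_int (int (Suc j)) * \<xi>) = cis (2 * pi * (real (Suc j) + 1) * \<xi>)"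
    and "?z * cis (2 * pi * of_int (- int (Suc j)) * \<xi>) = cis (- 2 * pi * real j * \<xi>)"
    by (simp_all add: cis_mult algebra_simps)
  moreover have "cis (2 * pi * of_int (int (Suc j)) * \<xi>) = cis (2 * pi * (real j + 1) * \<xi>)"
    and "cis (2 * pi * of_int (- int (Suc j)) * \<xi>) = cis (- 2 * pi * real (Suc j) * \<xi>)"
    by (simp_all add: algebra_simps)
  ultimately show ?case
    unfolding set using Suc by (simp add: ring_distribs del: of_nat_Suc of_int_minus of_int_of_nat_eq)
qed (simp add: cis_mult)

text \<open>The unnormalised Fejer kernel, with its denominator kept on the left so that integers
  need no separate treatment. The right side stays bounded as \<open>N\<close> grows.\<close>

lemma fejer_sum:
  "(cis (2 * pi * \<xi>) - 1)\<^sup>2 * (\<Sum>j<N. \<Sum>n\<in>{- int j..int j}. cis (2 * pi * of_int n * \<xi>))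
     = cis (2 * pi * (real N + 1) * \<xi>) + cis (2 * pi * (1 - real N) * \<xi>) - 2 * cis (2 * pi * \<xi>)"
proof (induction N)
  case (Suc N)
  let ?z = "cis (2 * pi * \<xi>)"
  have 1: "?z * cis (2 * pi * (real N + 1) * \<xi>) = cis (2 * pi * (real (Suc N) + 1) * \<xi>)"
    and 2: "?z * cis (- 2 * pi * real N * \<xi>) = cis (2 * pi * (1 - real N) * \<xi>)"
    and 3: "cis (- 2 * pi * real N * \<xi>) = cis (2 * pi * (1 - real (Suc N)) * \<xi>)"
    by (simp_all add: cis_mult algebra_simps)
  have "(?z - 1)\<^sup>2 * (\<Sum>j<Suc N. \<Sum>n\<in>{- int j..int j}. cis (2 * pi * of_int n * \<xi>))
    = (?z - 1)\<^sup>2 * (\<Sum>j<N. \<Sum>n\<in>{- int j..int j}. cis (2 * pi * of_int n * \<xi>))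
      + (?z - 1) * ((?z - 1) * (\<Sum>n\<in>{- int N..int N}. cis (2 * pi * of_int n * \<xi>)))"
    by (simp add: power2_eq_square ring_distribs)
  also have "\<dots> = cis (2 * pi * (real N + 1) * \<xi>) + cis (2 * pi * (1 - real N) * \<xi>) - 2 * ?z
      + (?z * cis (2 * pi * (real N + 1) * \<xi>) - ?z * cis (- 2 * pi * real N * \<xi>)
        - cis (2 * pi * (real N + 1) * \<xi>) + cis (- 2 * pi * real N * \<xi>))"
    unfolding Suc dirichlet_sum by (simp add: ring_distribs)
  also have "\<dots> = cis (2 * pi * (real (Suc N) + 1) * \<xi>) + cis (2 * pi * (1 - real (Suc N)) * \<xi>) - 2 * ?z"
    unfolding 1 2 unfolding 3 by simp
  finally show ?case .
qed (simp add: cis_mult)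

text \<open>A compact interval without integers keeps \<open>cis (2 * pi * \<xi>)\<close> at a
  distance of at least some \<open>\<delta> > 0\<close> from 1. The right side of
  \<open>fejer_sum\<close> has norm at most 1 + 1 + 2, which gives the bound
  \<open>4 / \<delta>\<^sup>2\<close>.\<close>

lemma fejer_sum_bound:
  assumes "\<And>\<xi>. \<bar>\<xi> - c\<bar> \<le> \<rho> \<Longrightarrow> \<xi> \<notin> \<int>"
  obtains s where "\<And>N \<xi>. \<bar>\<xi> - c\<bar> \<le> \<rho> \<Longrightarrow>
    norm (\<Sum>j<N. \<Sum>n\<in>{- int j..int j}. cis (2 * pi * of_int n * \<xi>)) \<le> s"
proof (cases "0 \<le> \<rho>")
  case False
  thus ?thesis using that[of 0] by fastforce
next
  case True
  have "\<exists>x\<in>cball c \<rho>. \<forall>y\<in>cball c \<rho>. norm (cis (2 * pi * x) - 1) \<le> norm (cis (2 * pi * y) - 1)"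
    using True by (intro continuous_attains_inf compact_cball continuous_intros) auto
  then obtain x where x: "x \<in> cball c \<rho>"
    "\<And>y. y \<in> cball c \<rho> \<Longrightarrow> norm (cis (2 * pi * x) - 1) \<le> norm (cis (2 * pi * y) - 1)"
    by blast
  have ball: "y \<in> cball c \<rho> \<longleftrightarrow> \<bar>y - c\<bar> \<le> \<rho>" for y
    by (simp add: dist_real_def abs_minus_commute)
  note x = x[unfolded ball]
  define \<delta> where "\<delta> = norm (cis (2 * pi * x) - 1)"
  have "0 < \<delta>"
  proof (rule ccontr)
    assume "\<not> 0 < \<delta>"
    hence "cis (2 * pi * x) = 1" by (simp add: \<delta>_def)
    hence "cos (2 * pi * x) = 1" by (simp add: complex_eq_iff)
    then obtain k :: int where "2 * pi * x = of_int k * 2 * pi"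
      using cos_one_2pi_int[of "2 * pi * x"] by auto
    hence "x \<in> \<int>" by simp
    with assms x(1) show False by blast
  qed
  have "norm (\<Sum>j<N. \<Sum>n\<in>{- int j..int j}. cis (2 * pi * of_int n * \<xi>)) \<le> 4 / \<delta>\<^sup>2"
    if "\<bar>\<xi> - c\<bar> \<le> \<rho>" for N \<xi>
  proof -
    let ?S = "\<Sum>j<N. \<Sum>n\<in>{- int j..int j}. cis (2 * pi * of_int n * \<xi>)"
    have "\<delta>\<^sup>2 * norm ?S \<le> (norm (cis (2 * pi * \<xi>) - 1))\<^sup>2 * norm ?S"
      using x(2)[OF that] by (intro mult_right_mono power_mono) (auto simp: \<delta>_def)
    also have "\<dots> = norm (cis (2 * pi * (real N + 1) * \<xi>) + cis (2 * pi * (1 - real N) * \<xi>)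
        - 2 * cis (2 * pi * \<xi>))"
      unfolding fejer_sum[symmetric] by (simp add: norm_mult norm_power)
    also have "\<dots> \<le> norm (cis (2 * pi * (real N + 1) * \<xi>)) + norm (cis (2 * pi * (1 - real N) * \<xi>))
        + norm (2 * cis (2 * pi * \<xi>))"
      by (intro order_trans[OF norm_triangle_ineq4] add_right_mono norm_triangle_ineq)
    also have "\<dots> = 4" by (simp add: norm_mult)
    finally show ?thesis using \<open>0 < \<delta>\<close> by (simp add: field_simps)
  qed
  thus ?thesis by (rule that)
qed

text \<open>If \<open>L\<close> were nonzero, all late terms would lie within
  \<open>norm L / 2\<close> of it, and the partial sums would grow linearly.\<close>

lemma bounded_partial_sums_imp_limit_0:
  fixes X :: "nat \<Rightarrow> complex"
  assumes X: "X \<longlonglongrightarrow> L" and C: "\<And>N. norm (\<Sum>j<N. X j) \<le> C"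
  shows "L = 0"
proof (rule ccontr)
  assume "L \<noteq> 0"
  then obtain J where J: "\<And>j. J \<le> j \<Longrightarrow> norm (X j - L) < norm L / 2"
    using LIMSEQ_D[OF X, of "norm L / 2"] by auto
  have le: "real N * (norm L / 2) \<le> 2 * C" for N
  proof -
    have "(\<Sum>j<J + N. X j) = (\<Sum>j<J. X j) + (\<Sum>j\<in>{J..<J + N}. X j)"
      using sum.atLeastLessThan_concat[of 0 J "J + N" X] by (simp add: lessThan_atLeast0)
    also have "(\<Sum>j\<in>{J..<J + N}. X j) = (\<Sum>j\<in>{J..<J + N}. X j - L) + real N * L"
      by (simp add: sum_subtractf)
    finally have eq: "real N * L = (\<Sum>j<J + N. X j) - (\<Sum>j<J. X j) - (\<Sum>j\<in>{J..<J + N}. X j - L)"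
      by simp
    have "norm (real N * L) \<le> norm (\<Sum>j<J + N. X j) + norm (\<Sum>j<J. X j)
        + norm (\<Sum>j\<in>{J..<J + N}. X j - L)"
      unfolding eq
      using norm_triangle_ineq4[of "(\<Sum>j<J + N. X j) - (\<Sum>j<J. X j)" "\<Sum>j\<in>{J..<J + N}. X j - L"]
        norm_triangle_ineq4[of "\<Sum>j<J + N. X j" "\<Sum>j<J. X j"] by linarith
    also have "norm (\<Sum>j\<in>{J..<J + N}. X j - L) \<le> (\<Sum>j\<in>{J..<J + N}. norm L / 2)"
      using J by (intro sum_norm_le less_imp_le) auto
    finally have "real N * norm L \<le> C + C + real N * (norm L / 2)"
      using C[of "J + N"] C[of J] by (simp add: norm_mult)
    thus ?thesis by simp
  qed
  have "0 < norm L / 2" using \<open>L \<noteq> 0\<close> by simp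
  from reals_Archimedean3[OF this] obtain N :: nat where "2 * C < real N * (norm L / 2)"
    by blast
  with le[of N] show False by simp
qed

lemma symmetric_partial_sums_tendsto:
  fixes h :: "int \<Rightarrow> complex"
  assumes "integrable int_counting h"
  shows "(\<lambda>j. \<Sum>n\<in>{- int j..int j}. h n) \<longlonglongrightarrow> (\<integral>n. h n \<partial>int_counting)"
proof -
  have "(\<integral>n. truncate j h n \<partial>int_counting) = (\<Sum>n\<in>{- int j..int j}. h n)" for j
  proof -
    have supp: "{n \<in> UNIV. truncate j h n \<noteq> 0} \<subseteq> {- int j..int j}"
      using truncate_eq_0 by blast
    hence "(\<integral>n. truncate j h n \<partial>int_counting) = (\<Sum>n\<in>{n \<in> UNIV. truncate j h n \<noteq> 0}. truncate j h n)"
      by (intro lebesgue_integral_count_space_finite_support) (auto intro: finite_subset)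
    also have "\<dots> = (\<Sum>n\<in>{- int j..int j}. truncate j h n)"
      using supp by (intro sum.mono_neutral_left) auto
    also have "\<dots> = (\<Sum>n\<in>{- int j..int j}. h n)"
      by (intro sum.cong) (auto simp: truncate_def)
    finally show ?thesis .
  qed
  moreover have "(\<lambda>j. \<integral>n. truncate j h n \<partial>int_counting) \<longlonglongrightarrow> (\<integral>n. h n \<partial>int_counting)"
    using assms norm_truncate_le truncate_tendsto
    by (intro integral_dominated_convergence[where w = "\<lambda>n. norm (h n)"]) auto
  ultimately show ?thesis by simp
qed

text \<open>Bounding the symmetric partial sums of \<open>h\<close> would not show that their limit
  is zero. Here the sums over \<open>j < N\<close> of these partial sums are bounded uniformly in
  \<open>N\<close>, which leaves no limit but zero.\<close>

lemma spectral_bound_integral_eq_0: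
  assumes h: "spectral_bound c \<rho> B h" "integrable int_counting h"
    and nonint: "\<And>\<xi>. \<bar>\<xi> - c\<bar> \<le> \<rho> \<Longrightarrow> \<xi> \<notin> \<int>"
  shows "(\<integral>n. h n \<partial>int_counting) = 0"
proof -
  obtain s where s: "\<And>N \<xi>. \<bar>\<xi> - c\<bar> \<le> \<rho> \<Longrightarrow>
      norm (\<Sum>j<N. \<Sum>n\<in>{- int j..int j}. cis (2 * pi * of_int n * \<xi>)) \<le> s"
    using fejer_sum_bound[OF nonint] by blast
  have "norm (\<Sum>j<N. \<Sum>n\<in>{- int j..int j}. h n) \<le> B * s" for N
  proof -
    \<comment> \<open>The same integer occurs for several \<open>j\<close>. The first component of
      the pairs in \<open>spectral_bound\<close> is a label that keeps these occurrences
      apart.\<close>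
    let ?I = "SIGMA j:{..<N}. {- int j..int j}"
    have I: "(\<Sum>i\<in>?I. 1 * F (snd i)) = (\<Sum>j<N. \<Sum>n\<in>{- int j..int j}. F n)" for F :: "int \<Rightarrow> complex"
      by (subst sum.Sigma) (auto simp: case_prod_unfold)
    have "norm (\<Sum>i\<in>?I. 1 * h (snd i)) \<le> B * s"
      using h(1)[unfolded spectral_bound_def, rule_format, of ?I "\<lambda>_. 1" s] s
      unfolding I by (auto simp: I[of "\<lambda>n. cis (2 * pi * of_int n * _)", simplified])
    thus ?thesis unfolding I .
  qed
  with symmetric_partial_sums_tendsto[OF h(2)] show ?thesis
    by (rule bounded_partial_sums_imp_limit_0)
qed

section \<open>Limits of products of sequences\<close>

text \<open>Dominated convergence with a majorant that varies with \<open>k\<close> by an amount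
  tending to zero in mean. Convergence in energy yields such a majorant, but not directly a fixed
  one.\<close>

lemma integral_tendsto_of_perturbed_domination:
  fixes u :: "nat \<Rightarrow> 'a \<Rightarrow> complex"
  assumes u: "\<And>k. integrable M (u k)" "integrable M u0"
    and lim: "\<And>x. x \<in> space M \<Longrightarrow> (\<lambda>k. u k x) \<longlonglongrightarrow> u0 x"
    and v: "integrable M v" and z: "\<And>k. integrable M (z k)" "(\<lambda>k. \<integral>x. z k x \<partial>M) \<longlonglongrightarrow> 0"
    and z_nonneg: "\<And>k x. 0 \<le> z k x"
    and le: "\<And>k x. norm (u k x) \<le> v x + z k x" "\<And>x. norm (u0 x) \<le> v x"
  shows "(\<lambda>k. \<integral>x. u k x \<partial>M) \<longlonglongrightarrow> (\<integral>x. u0 x \<partial>M)"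
proof -
  \<comment> \<open>The part of the error that the fixed majorant controls; the rest is at most
    \<open>z k x\<close>.\<close>
  define w where "w k x = min (norm (u k x - u0 x)) (2 * v x)" for k x
  have v_nonneg: "0 \<le> v x" for x
    using order_trans[OF norm_ge_zero le(2)] .
  have w_int: "integrable M (w k)" for k
    unfolding w_def using u v by (intro integrable_min) auto
  have "(\<lambda>k. \<integral>x. w k x \<partial>M) \<longlonglongrightarrow> (\<integral>x. 0 \<partial>M)"
  proof (rule integral_dominated_convergence[where w = "\<lambda>x. 2 * v x"])
    show "AE x in M. (\<lambda>k. w k x) \<longlonglongrightarrow> 0"
    proof (rule AE_I2)
      fix x assume "x \<in> space M"
      hence "(\<lambda>k. w k x) \<longlonglongrightarrow> min (norm (u0 x - u0 x)) (2 * v x)"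
        unfolding w_def by (intro tendsto_intros lim)
      thus "(\<lambda>k. w k x) \<longlonglongrightarrow> 0" using v_nonneg[of x] by simp
    qed
    show "AE x in M. norm (w k x) \<le> 2 * v x" for k
      using v_nonneg by (intro AE_I2) (auto simp: w_def)
  qed (use w_int v in auto)
  hence wz: "(\<lambda>k. (\<integral>x. w k x \<partial>M) + (\<integral>x. z k x \<partial>M)) \<longlonglongrightarrow> 0"
    using z(2) by (auto intro: tendsto_add_zero)
  have le: "norm ((\<integral>x. u k x \<partial>M) - (\<integral>x. u0 x \<partial>M)) \<le> (\<integral>x. w k x \<partial>M) + (\<integral>x. z k x \<partial>M)" for k
  proof -
    have "norm ((\<integral>x. u k x \<partial>M) - (\<integral>x. u0 x \<partial>M)) = norm (\<integral>x. u k x - u0 x \<partial>M)"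
      using u by simp
    also have "\<dots> \<le> (\<integral>x. norm (u k x - u0 x) \<partial>M)"
      by (rule integral_norm_bound)
    also have "\<dots> \<le> (\<integral>x. w k x + z k x \<partial>M)"
    proof (rule integral_mono)
      show "norm (u k x - u0 x) \<le> w k x + z k x" for x
        using norm_triangle_ineq4[of "u k x" "u0 x"] le(1)[of k x] le(2)[of x] z_nonneg[of k x]
        by (auto simp: w_def min_def)
    qed (use u w_int z in auto)
    finally show ?thesis using w_int z by simp
  qed
  have "(\<lambda>k. (\<integral>x. u k x \<partial>M) - (\<integral>x. u0 x \<partial>M)) \<longlonglongrightarrow> 0"
    by (rule Lim_null_comparison[OF always_eventually[OF allI[OF le]] wz])
  thus ?thesis by (simp add: LIM_zero_iff)
qed

text \<open>A substitute for Hoelder's inequality: every factor is at most the largest one, whose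
  power is among the summands. For empty \<open>J\<close> the left side would be 1 and the right
  side 0.\<close>

lemma prod_le_sum_power:
  fixes a :: "'a \<Rightarrow> real"
  assumes "finite J" "J \<noteq> {}" "\<And>i. i \<in> J \<Longrightarrow> 0 \<le> a i"
  shows "(\<Prod>i\<in>J. a i) \<le> (\<Sum>i\<in>J. a i ^ card J)"
proof -
  have "Max (a ` J) \<in> a ` J" using assms by (intro Max_in) auto
  then obtain j where j: "j \<in> J" "Max (a ` J) = a j" by auto
  have "(\<Prod>i\<in>J. a i) \<le> (\<Prod>i\<in>J. a j)"
    using assms by (intro prod_mono) (auto simp flip: j(2))
  also have "\<dots> = a j ^ card J" by simp
  also have "\<dots> \<le> (\<Sum>i\<in>J. a i ^ card J)"
    using assms j(1) by (intro member_le_sum) auto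
  finally show ?thesis .
qed

text \<open>The exponent is the number of factors, which makes the products summable.\<close>

lemma integral_prod_tendsto:
  fixes G :: "nat \<Rightarrow> 'a \<Rightarrow> int \<Rightarrow> complex" and g :: "'a \<Rightarrow> int \<Rightarrow> complex"
  assumes J: "finite J" "J \<noteq> {}"
    and Gfin: "\<And>k i. i \<in> J \<Longrightarrow> energy (card J) (G k i) < \<infinity>"
    and gfin: "\<And>i. i \<in> J \<Longrightarrow> energy (card J) (g i) < \<infinity>"
    and lim: "\<And>i. i \<in> J \<Longrightarrow> (\<lambda>k. energy (card J) (\<lambda>n. G k i n - g i n)) \<longlonglongrightarrow> 0"
  shows "\<And>k. integrable int_counting (\<lambda>n. \<Prod>i\<in>J. G k i n)"
    and "integrable int_counting (\<lambda>n. \<Prod>i\<in>J. g i n)"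
    and "(\<lambda>k. \<integral>n. (\<Prod>i\<in>J. G k i n) \<partial>int_counting) \<longlonglongrightarrow> (\<integral>n. (\<Prod>i\<in>J. g i n) \<partial>int_counting)"
proof -
  let ?P = "card J"
  have P: "1 \<le> ?P" using J by (simp add: Suc_le_eq card_gt_0_iff)
  have int_prod: "integrable int_counting (\<lambda>n. \<Prod>i\<in>J. F i n)"
    if "\<And>i. i \<in> J \<Longrightarrow> energy ?P (F i) < \<infinity>" for F :: "'a \<Rightarrow> int \<Rightarrow> complex"
  proof (rule Bochner_Integration.integrable_bound)
    show "integrable int_counting (\<lambda>n. \<Sum>i\<in>J. norm (F i n) ^ ?P)"
      using that unfolding energy_finite_iff by (intro Bochner_Integration.integrable_sum)
    show "AE n in int_counting. norm (\<Prod>i\<in>J. F i n) \<le> norm (\<Sum>i\<in>J. norm (F i n) ^ ?P)"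
      using prod_le_sum_power[OF J, of "\<lambda>i. norm (F i _)"]
      by (intro AE_I2) (auto simp: prod_norm[symmetric] sum_nonneg)
  qed simp
  show G: "integrable int_counting (\<lambda>n. \<Prod>i\<in>J. G k i n)" for k
    by (intro int_prod Gfin)
  show g: "integrable int_counting (\<lambda>n. \<Prod>i\<in>J. g i n)"
    by (intro int_prod gfin)
  have dfin: "energy ?P (\<lambda>n. G k i n - g i n) < \<infinity>" if "i \<in> J" for k i
  proof -
    have "energy ?P (\<lambda>n. G k i n - g i n) \<le> 2 ^ ?P * (energy ?P (G k i) + energy ?P (g i))"
      using energy_add_le[of ?P "G k i" "\<lambda>n. - g i n"] by (simp add: energy_def)
    also have "\<dots> < \<infinity>"
      using Gfin[OF that] gfin[OF that]
      by (simp add: ennreal_mult_less_top ennreal_power flip: ennreal_numeral)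
    finally show ?thesis .
  qed
  \<comment> \<open>The factor \<open>2 ^ ?P\<close> comes from splitting \<open>G k i n\<close>
    into \<open>g i n\<close> and the error \<open>G k i n - g i n\<close>; the errors make up
    \<open>z\<close>.\<close>
  define v where "v n = 2 ^ ?P * (\<Sum>i\<in>J. norm (g i n) ^ ?P)" for n
  define z where "z k n = 2 ^ ?P * (\<Sum>i\<in>J. norm (G k i n - g i n) ^ ?P)" for k n
  show "(\<lambda>k. \<integral>n. (\<Prod>i\<in>J. G k i n) \<partial>int_counting) \<longlonglongrightarrow> (\<integral>n. (\<Prod>i\<in>J. g i n) \<partial>int_counting)"
  proof (rule integral_tendsto_of_perturbed_domination[where v = v and z = z])
    show "(\<lambda>k. \<Prod>i\<in>J. G k i n) \<longlonglongrightarrow> (\<Prod>i\<in>J. g i n)" for n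
      by (intro tendsto_prod energy_tendsto_0_pointwise[OF P lim])
    show "integrable int_counting v"
      unfolding v_def using gfin unfolding energy_finite_iff
      by (intro integrable_mult_right Bochner_Integration.integrable_sum)
    have dint: "integrable int_counting (\<lambda>n. norm (G k i n - g i n) ^ ?P)" if "i \<in> J" for k i
      using dfin[OF that] unfolding energy_finite_iff .
    show "integrable int_counting (z k)" for k
      unfolding z_def by (intro integrable_mult_right Bochner_Integration.integrable_sum dint)
    have "(\<lambda>k. \<integral>n. norm (G k i n - g i n) ^ ?P \<partial>int_counting) \<longlonglongrightarrow> 0" if "i \<in> J" for i
      using lim[OF that] unfolding energy_eq_integral[OF dfin[OF that]]
      by (subst (asm) ennreal_tendsto_0_iff) auto
    hence "(\<lambda>k. 2 ^ ?P * (\<Sum>i\<in>J. \<integral>n. norm (G k i n - g i n) ^ ?P \<partial>int_counting)) \<longlonglongrightarrow> 2 ^ ?P * (\<Sum>i\<in>J. 0)"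
      by (intro tendsto_intros)
    thus "(\<lambda>k. \<integral>n. z k n \<partial>int_counting) \<longlonglongrightarrow> 0"
      unfolding z_def using dint by (simp add: Bochner_Integration.integral_sum)
    show "0 \<le> z k n" for k n
      by (simp add: z_def sum_nonneg)
    show "norm (\<Prod>i\<in>J. G k i n) \<le> v n + z k n" for k n
    proof -
      have "norm (\<Prod>i\<in>J. G k i n) \<le> (\<Sum>i\<in>J. norm (G k i n) ^ ?P)"
        unfolding prod_norm[symmetric] by (intro prod_le_sum_power J) auto
      also have "\<dots> \<le> (\<Sum>i\<in>J. 2 ^ ?P * (norm (g i n) ^ ?P + norm (G k i n - g i n) ^ ?P))"
      proof (rule sum_mono)
        fix i
        have "norm (G k i n) \<le> 2 * max (norm (g i n)) (norm (G k i n - g i n))"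
          using norm_triangle_ineq[of "g i n" "G k i n - g i n"] by simp
        hence "norm (G k i n) ^ ?P \<le> (2 * max (norm (g i n)) (norm (G k i n - g i n))) ^ ?P"
          by (intro power_mono) auto
        also have "\<dots> \<le> 2 ^ ?P * (norm (g i n) ^ ?P + norm (G k i n - g i n) ^ ?P)"
          by (auto simp: power_mult_distrib max_def)
        finally show "norm (G k i n) ^ ?P \<le> 2 ^ ?P * (norm (g i n) ^ ?P + norm (G k i n - g i n) ^ ?P)" .
      qed
      also have "\<dots> = v n + z k n"
        by (simp add: v_def z_def sum_distrib_left sum.distrib distrib_left)
      finally show ?thesis .
    qed
    show "norm (\<Prod>i\<in>J. g i n) \<le> v n" for n
    proof -
      have "norm (\<Prod>i\<in>J. g i n) \<le> (\<Sum>i\<in>J. norm (g i n) ^ ?P)"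
        unfolding prod_norm[symmetric] by (intro prod_le_sum_power J) auto
      also have "\<dots> \<le> v n"
        unfolding v_def
        using mult_right_mono[of 1 "2 ^ ?P" "\<Sum>i\<in>J. norm (g i n) ^ ?P"] by (simp add: sum_nonneg)
      finally show ?thesis .
    qed
  qed (use G g in auto)
qed

section \<open>Products of pieces and conjugated pieces\<close>

definition signed :: "bool \<Rightarrow> complex \<Rightarrow> complex" where
  "signed b z = (if b then z else cnj z)"

lemma norm_signed [simp]: "norm (signed b z) = norm z"
  by (simp add: signed_def)

lemma norm_signed_diff: "norm (signed b z - signed b w) = norm (z - w)"
  by (simp add: signed_def flip: complex_cnj_diff)

text \<open>Conjugation reflects the frequency variable, hence the centre \<open>- \<theta>\<close>.
  \<open>B'\<close> stays existential, since the vanishing of the sum only asks for some finite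
  constant.\<close>

lemma (in freq_projection) spectral_bound_mult_freq_piece_l1:
  assumes h: "spectral_bound c \<rho> B h" and f: "integrable int_counting f"
  shows "\<exists>B'. spectral_bound (c + (if b then \<theta> else - \<theta>)) (\<rho> + \<epsilon> / 2) B'
    (\<lambda>n. h n * signed b (freq_piece_l1 m \<epsilon> \<theta> f n))"
proof -
  have supp: "\<bar>\<xi> - \<theta>\<bar> \<le> \<epsilon> / 2" if "density f \<xi> \<noteq> 0" for \<xi>
    using density_supp[of \<xi> f] that by force
  note int = integrable_density_cis[OF f]
  show ?thesis
  proof (cases b)
    case True
    show ?thesis
      by (rule exI, rule spectral_bound_mult[OF h integrable_density[OF f], where \<tau> = "\<lambda>\<xi>. \<xi>"])
         (use True supp in \<open>auto simp: signed_def freq_piece_l1_eq[OF f] intro: int\<close>)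
  next
    case False
    have eq: "cnj (density f x) * cis (2 * pi * of_int n * - x) = cnj (density f x * cis (2 * pi * of_int n * x))" for n x
      by (simp add: cis_cnj)
    have cnj_int: "integrable lebesgue (\<lambda>x. cnj (density f x))"
      using integrable_density[OF f] by simp
    show ?thesis
    proof (rule exI, rule spectral_bound_mult[OF h cnj_int, where \<tau> = "\<lambda>\<xi>. - \<xi>"])
      show "integrable lebesgue (\<lambda>x. cnj (density f x) * cis (2 * pi * of_int n * - x))" for n
        unfolding eq complex_integrable_cnj by (rule int)
      show "signed b (freq_piece_l1 m \<epsilon> \<theta> f n)
          = (\<integral>x. cnj (density f x) * cis (2 * pi * of_int n * - x) \<partial>lebesgue)" for n
        unfolding eq using False by (simp add: signed_def freq_piece_l1_eq[OF f] del: complex_cnj_mult)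
      show "\<bar>- x - (if b then \<theta> else - \<theta>)\<bar> \<le> \<epsilon> / 2" if "cnj (density f x) \<noteq> 0" for x
        using supp[of x] that False by (simp add: abs_minus_commute)
    qed
  qed
qed

text \<open>Each factor moves the centre by plus or minus \<open>\<theta> i\<close> and adds
  \<open>\<epsilon> / 2\<close> to the half-width. The vanishing is exact for every truncation of
  \<open>f\<close>, and so holds for the limit of the integrals.\<close>

lemma signed_freq_piece_prod:
  fixes J :: "'a set" and \<theta> :: "'a \<Rightarrow> real" and b :: "'a \<Rightarrow> bool"
  assumes J: "finite J" "J \<noteq> {}"
    and proj: "\<And>i. i \<in> J \<Longrightarrow> freq_projection m \<epsilon> (\<theta> i) M"
    and mult: "Lp_multiplier (real (card J)) m" and f: "energy (card J) f < \<infinity>"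
  shows "integrable int_counting (\<lambda>n. \<Prod>i\<in>J. signed (b i) (freq_piece (real (card J)) m \<epsilon> (\<theta> i) f n))"
    and "(\<And>l::int. real (card J) * (\<epsilon> / 2) < \<bar>(\<Sum>i\<in>J. if b i then \<theta> i else - \<theta> i) - of_int l\<bar>) \<Longrightarrow>
      (\<integral>n. (\<Prod>i\<in>J. signed (b i) (freq_piece (real (card J)) m \<epsilon> (\<theta> i) f n)) \<partial>int_counting) = 0"
proof -
  let ?P = "card J"
  have P: "1 \<le> ?P" using J by (simp add: Suc_le_eq card_gt_0_iff)
  define G where "G k i n = signed (b i) (freq_piece_l1 m \<epsilon> (\<theta> i) (truncate k f) n)" for k i n
  define g where "g i n = signed (b i) (freq_piece (real ?P) m \<epsilon> (\<theta> i) f n)" for i n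
  have Gfin: "energy ?P (G k i) < \<infinity>" and gfin: "energy ?P (g i) < \<infinity>"
    and lim: "(\<lambda>k. energy ?P (\<lambda>n. G k i n - g i n)) \<longlonglongrightarrow> 0" if "i \<in> J" for i k
  proof -
    interpret freq_projection m \<epsilon> "\<theta> i" M using proj[OF that] .
    show "energy ?P (G k i) < \<infinity>"
      using energy_freq_piece_l1_truncate_finite[OF P mult f, of k] by (simp add: energy_def G_def)
    show "energy ?P (g i) < \<infinity>"
      using energy_freq_piece_finite[OF P mult f] by (simp add: energy_def g_def)
    show "(\<lambda>k. energy ?P (\<lambda>n. G k i n - g i n)) \<longlonglongrightarrow> 0"
      using freq_piece_truncate_tendsto[OF P mult f] by (simp add: energy_def G_def g_def norm_signed_diff)
  qed
  note tends = integral_prod_tendsto[OF J, of G g, OF Gfin gfin lim]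
  show "integrable int_counting (\<lambda>n. \<Prod>i\<in>J. signed (b i) (freq_piece (real ?P) m \<epsilon> (\<theta> i) f n))"
    using tends(2) by (simp add: g_def)
  assume far: "\<And>l::int. real ?P * (\<epsilon> / 2) < \<bar>(\<Sum>i\<in>J. if b i then \<theta> i else - \<theta> i) - of_int l\<bar>"
  have "(\<integral>n. (\<Prod>i\<in>J. G k i n) \<partial>int_counting) = 0" for k
  proof -
    \<comment> \<open>The constant may depend on \<open>k\<close>: each truncation is shown to give
      zero on its own.\<close>
    have "\<exists>B. spectral_bound (\<Sum>i\<in>J'. if b i then \<theta> i else - \<theta> i) (real (card J') * (\<epsilon> / 2)) B
        (\<lambda>n. \<Prod>i\<in>J'. G k i n)" if "finite J'" "J' \<subseteq> J" for J'
      using that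
    proof (induction J' rule: finite_induct)
      case empty
      show ?case using spectral_bound_one by auto
    next
      case (insert i J')
      then obtain B where B: "spectral_bound (\<Sum>i\<in>J'. if b i then \<theta> i else - \<theta> i)
          (real (card J') * (\<epsilon> / 2)) B (\<lambda>n. \<Prod>i\<in>J'. G k i n)"
        by auto
      interpret freq_projection m \<epsilon> "\<theta> i" M using proj[of i] insert.prems by simp
      let ?s = "if b i then \<theta> i else - \<theta> i"
      have "\<exists>B'. spectral_bound ((\<Sum>i\<in>J'. if b i then \<theta> i else - \<theta> i) + ?s)
          (real (card J') * (\<epsilon> / 2) + \<epsilon> / 2) B' (\<lambda>n. (\<Prod>i\<in>J'. G k i n) * G k i n)"
        unfolding G_def[of k i]
        by (rule spectral_bound_mult_freq_piece_l1[OF B integrable_truncate[of k f], of "b i"])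
      moreover have "(\<Sum>i\<in>insert i J'. if b i then \<theta> i else - \<theta> i)
          = (\<Sum>i\<in>J'. if b i then \<theta> i else - \<theta> i) + ?s"
        unfolding sum.insert[OF insert.hyps] by (rule add.commute)
      moreover have "real (card (insert i J')) * (\<epsilon> / 2) = real (card J') * (\<epsilon> / 2) + \<epsilon> / 2"
        using insert.hyps by (simp add: distrib_right add_divide_distrib)
      moreover have "(\<Prod>i\<in>insert i J'. G k i n) = (\<Prod>i\<in>J'. G k i n) * G k i n" for n
        unfolding prod.insert[OF insert.hyps] by (rule mult.commute)
      ultimately show ?case by (simp only:)
    qed
    from this[OF J(1)] obtain B where B:
      "spectral_bound (\<Sum>i\<in>J. if b i then \<theta> i else - \<theta> i) (real ?P * (\<epsilon> / 2)) B (\<lambda>n. \<Prod>i\<in>J. G k i n)"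
      by auto
    show ?thesis
    proof (rule spectral_bound_integral_eq_0[OF B tends(1)])
      fix \<xi> assume \<xi>: "\<bar>\<xi> - (\<Sum>i\<in>J. if b i then \<theta> i else - \<theta> i)\<bar> \<le> real ?P * (\<epsilon> / 2)"
      show "\<xi> \<notin> \<int>"
      proof
        assume "\<xi> \<in> \<int>"
        then obtain l where "\<xi> = of_int l" by (auto elim: Ints_cases)
        with far[of l] \<xi> show False by (simp add: abs_minus_commute)
      qed
    qed
  qed
  with tends(3) have "(\<lambda>k::nat. 0) \<longlonglongrightarrow> (\<integral>n. (\<Prod>i\<in>J. g i n) \<partial>int_counting)"
    by simp
  thus "(\<integral>n. (\<Prod>i\<in>J. signed (b i) (freq_piece (real ?P) m \<epsilon> (\<theta> i) f n)) \<partial>int_counting) = 0"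
    by (simp add: LIMSEQ_const_iff g_def)
qed

section \<open>Arithmetic of the frequencies\<close>

text \<open>Multiplied by the product of the denominators, the difference becomes an integer, so a
  distance below the claimed bound makes it zero. Reducing the resulting equation modulo each
  \<open>q i\<close> then forces equal numerators.\<close>

lemma reduced_fracs_separation:
  fixes q :: "'a \<Rightarrow> nat"
  assumes I: "finite I" and q: "\<And>i. i \<in> I \<Longrightarrow> 0 < q i"
    and cop: "\<And>i j. i \<in> I \<Longrightarrow> j \<in> I \<Longrightarrow> i \<noteq> j \<Longrightarrow> coprime (q i) (q j)"
    and \<alpha>: "\<And>i. i \<in> I \<Longrightarrow> \<alpha> i \<in> reduced_fracs (q i)"
    and \<beta>: "\<And>i. i \<in> I \<Longrightarrow> \<beta> i \<in> reduced_fracs (q i)"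
    and ne: "\<exists>i\<in>I. \<alpha> i \<noteq> \<beta> i"
  shows "1 / real (\<Prod>i\<in>I. q i) \<le> \<bar>(\<Sum>i\<in>I. \<alpha> i - \<beta> i) - of_int l\<bar>"
proof (rule ccontr)
  assume lt: "\<not> ?thesis"
  define D where "D = (\<Prod>i\<in>I. q i)"
  define c where "c i = (\<Prod>j\<in>I - {i}. q j)" for i
  have "D > 0" using q by (auto simp: D_def intro!: prod_pos)
  have D: "D = q i * c i" if "i \<in> I" for i
    unfolding D_def c_def using I that by (rule prod.remove)
  have "\<forall>i\<in>I. \<exists>a. \<alpha> i = real a / real (q i) \<and> 1 \<le> a \<and> a \<le> q i"
    using \<alpha> unfolding reduced_fracs_def by blast
  then obtain a where a: "\<And>i. i \<in> I \<Longrightarrow> \<alpha> i = real (a i) / real (q i) \<and> 1 \<le> a i \<and> a i \<le> q i"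
    by metis
  have "\<forall>i\<in>I. \<exists>a. \<beta> i = real a / real (q i) \<and> 1 \<le> a \<and> a \<le> q i"
    using \<beta> unfolding reduced_fracs_def by blast
  then obtain b where b: "\<And>i. i \<in> I \<Longrightarrow> \<beta> i = real (b i) / real (q i) \<and> 1 \<le> b i \<and> b i \<le> q i"
    by metis
  have "real D * (\<Sum>i\<in>I. \<alpha> i - \<beta> i) = (\<Sum>i\<in>I. real_of_int ((int (a i) - int (b i)) * int (c i)))"
    unfolding sum_distrib_left
  proof (rule sum.cong)
    fix i assume "i \<in> I"
    thus "real D * (\<alpha> i - \<beta> i) = real_of_int ((int (a i) - int (b i)) * int (c i))"
      using a[of i] b[of i] q[of i] by (simp add: D field_simps)
  qed simp
  hence "real D * ((\<Sum>i\<in>I. \<alpha> i - \<beta> i) - of_int l)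
      = real_of_int ((\<Sum>i\<in>I. (int (a i) - int (b i)) * int (c i)) - int D * l)"
    by (simp add: right_diff_distrib)
  moreover have "real D * \<bar>(\<Sum>i\<in>I. \<alpha> i - \<beta> i) - of_int l\<bar> < 1"
    using lt \<open>D > 0\<close> by (simp add: D_def[symmetric] field_simps not_le del: of_nat_prod)
  hence "\<bar>real D * ((\<Sum>i\<in>I. \<alpha> i - \<beta> i) - of_int l)\<bar> < 1"
    by (simp only: abs_mult abs_of_nat)
  ultimately have "(\<Sum>i\<in>I. (int (a i) - int (b i)) * int (c i)) - int D * l = 0"
    by linarith
  hence sum_eq: "(\<Sum>i\<in>I. (int (a i) - int (b i)) * int (c i)) = int D * l"
    by simp
  have "\<alpha> i = \<beta> i" if i: "i \<in> I" for i
  proof -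
    \<comment> \<open>For \<open>j\<close> other than \<open>i\<close> the cofactor
      \<open>c j\<close> contains \<open>q i\<close>, so modulo \<open>q i\<close> only the term of
      index \<open>i\<close> survives.\<close>
    have "int (q i) dvd (\<Sum>j\<in>I - {i}. (int (a j) - int (b j)) * int (c j))"
    proof (rule dvd_sum)
      fix j assume j: "j \<in> I - {i}"
      have "q i dvd c j"
        unfolding c_def using I i j by (intro dvd_prodI) auto
      thus "int (q i) dvd (int (a j) - int (b j)) * int (c j)"
        by (intro dvd_mult) simp
    qed
    moreover have "int (q i) dvd int D * l"
      using D[OF i] by simp
    moreover have "(int (a i) - int (b i)) * int (c i)
        = int D * l - (\<Sum>j\<in>I - {i}. (int (a j) - int (b j)) * int (c j))"
      using sum_eq sum.remove[OF I i, of "\<lambda>i. (int (a i) - int (b i)) * int (c i)"] by simp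
    ultimately have "int (q i) dvd (int (a i) - int (b i)) * int (c i)"
      by (simp only: dvd_diff)
    moreover have "coprime (q i) (c i)"
      unfolding c_def using cop i by (intro prod_coprime_right) auto
    hence "coprime (int (q i)) (int (c i))" by simp
    ultimately have "int (q i) dvd int (a i) - int (b i)"
      by (simp add: coprime_dvd_mult_left_iff)
    \<comment> \<open>Both numerators lie between 1 and \<open>q i\<close>, so congruent ones are
      equal.\<close>
    moreover have "\<bar>int (a i) - int (b i)\<bar> < int (q i)"
      using a[OF i] b[OF i] by linarith
    ultimately have "int (a i) - int (b i) = 0"
      using dvd_imp_le_int[of "int (a i) - int (b i)" "int (q i)"] by linarith
    thus ?thesis using a[OF i] b[OF i] by simp
  qed
  with ne show False by blast
qed

lemma finite_reduced_fracs: "finite (reduced_fracs q)"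
  by (rule finite_subset[of _ "(\<lambda>a. real a / real q) ` {..q}"]) (auto simp: reduced_fracs_def)

lemma reduced_fracs_bounds: "\<theta> \<in> reduced_fracs q \<Longrightarrow> 0 \<le> \<theta> \<and> \<theta> \<le> 1"
  by (auto simp: reduced_fracs_def divide_le_eq)

lemma prod_powr_inverse_power:
  fixes x :: "nat \<Rightarrow> real"
  assumes "1 \<le> r" "\<And>i. i < r \<Longrightarrow> 0 \<le> x i"
  shows "norm (\<Prod>i<r. x i powr (1 / real r)) ^ (2 * r) = (\<Prod>i<r. (x i)\<^sup>2)"
proof -
  have "norm (\<Prod>i<r. x i powr (1 / real r)) ^ (2 * r) = (\<Prod>i<r. (x i powr (1 / real r)) ^ (2 * r))"
    by (simp add: abs_prod prod_power_distrib)
  also have "\<dots> = (\<Prod>i<r. (x i)\<^sup>2)"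
  proof (rule prod.cong)
    fix i assume "i \<in> {..<r}"
    hence "0 \<le> x i" using assms by simp
    have "(x i powr (1 / real r)) ^ (2 * r) = ((x i powr (1 / real r)) ^ r)\<^sup>2"
      by (simp add: power_mult[symmetric] mult.commute)
    also have "(x i powr (1 / real r)) ^ r = x i"
      using \<open>0 \<le> x i\<close> assms(1) by (simp add: powr_of_nat[symmetric] powr_powr)
    finally show "(x i powr (1 / real r)) ^ (2 * r) = (x i)\<^sup>2" .
  qed simp
  finally show ?thesis .
qed

lemma norm_sum_squared:
  fixes g :: "'a \<Rightarrow> complex"
  assumes "finite A"
  shows "complex_of_real ((norm (\<Sum>x\<in>A. g x))\<^sup>2) = (\<Sum>p\<in>A \<times> A. g (fst p) * cnj (g (snd p)))"
  unfolding complex_norm_square cnj_sum sum_product sum.cartesian_product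
  by (simp add: case_prod_unfold)

text \<open>Written over all pairs, with zeros off the diagonal, so that it can be compared termwise
  with \<open>norm_sum_squared\<close>.\<close>

lemma sum_norm_squared:
  fixes g :: "'a \<Rightarrow> complex"
  assumes "finite A"
  shows "complex_of_real (\<Sum>x\<in>A. (norm (g x))\<^sup>2)
    = (\<Sum>p\<in>A \<times> A. if fst p = snd p then g (fst p) * cnj (g (snd p)) else 0)"
proof -
  have "(\<Sum>p\<in>A \<times> A. if fst p = snd p then g (fst p) * cnj (g (snd p)) else 0)
      = (\<Sum>x\<in>A. \<Sum>y\<in>A. if x = y then g x * cnj (g y) else 0)"
    unfolding sum.cartesian_product by (simp add: case_prod_unfold)
  also have "\<dots> = (\<Sum>x\<in>A. g x * cnj (g x))"
    using assms by simp
  finally show ?thesis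
    unfolding of_real_sum complex_norm_square by simp
qed

theorem lemma5p10:
  fixes r :: nat and m :: "real \<Rightarrow> complex"
  assumes "r \<ge> 1"
    and "Lp_multiplier (2 * real r) m"
    and "\<forall>\<xi>. \<xi> \<notin> {-1/2<..1/2} \<longrightarrow> m \<xi> = 0"
  shows "\<exists>C::real. \<forall>(q :: nat \<Rightarrow> nat) (\<epsilon> :: real) (f :: int \<Rightarrow> complex).
    (\<forall>i<r. q i > 0) \<and> inj_on q {..<r} \<and>
    (\<forall>i<r. \<forall>j<r. i \<noteq> j \<longrightarrow> coprime (q i) (q j)) \<and>
    0 < \<epsilon> \<and> \<epsilon> < inverse (real r) * inverse (real (Max (q ` {..<r})) ^ (2 * r)) \<and>
    lp_norm (2 * real r) f < \<infinity> \<longrightarrow>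
    lp_norm (2 * real r)
      (\<lambda>n. \<Prod>i<r. norm (freq_sum (2 * real r) m \<epsilon> (q i) f n) powr (1 / real r))
    \<le> ennreal C * lp_norm (2 * real r)
      (\<lambda>n. \<Prod>i<r. freq_square (2 * real r) m \<epsilon> (q i) f n powr (1 / real r))"
proof (intro exI[of _ 1] allI impI, elim conjE)
  fix q :: "nat \<Rightarrow> nat" and \<epsilon> :: real and f :: "int \<Rightarrow> complex"
  assume q: "\<forall>i<r. q i > 0" and cop: "\<forall>i<r. \<forall>j<r. i \<noteq> j \<longrightarrow> coprime (q i) (q j)"
    and eps: "0 < \<epsilon>" "\<epsilon> < inverse (real r) * inverse (real (Max (q ` {..<r})) ^ (2 * r))"
    and f: "lp_norm (2 * real r) f < \<infinity>"
  define P where "P = 2 * r"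
  have P: "1 \<le> P" "2 * real r = real P" using assms(1) by (auto simp: P_def)
  note mult = assms(2)[unfolded P(2)]
  have f: "energy P f < \<infinity>"
    using f unfolding P(2) lp_norm_finite_iff_energy[OF P(1)] .
  define Q where "Q = Max (q ` {..<r})"
  have qQ: "q i \<le> Q" if "i < r" for i
    unfolding Q_def using that by (intro Max_ge) auto
  have "1 \<le> Q"
    using q qQ[of 0] assms(1) by (auto dest!: spec[of _ 0])
  have reps: "real r * \<epsilon> < 1 / real Q ^ (2 * r)"
    using mult_strict_left_mono[OF eps(2), of "real r"] assms(1)
    by (simp add: Q_def inverse_eq_divide)
  \<comment> \<open>The left side is \<open>real r * \<epsilon>\<close>, the total half-width of the
    2r factors. The product of the \<open>q i\<close> is at most \<open>Q ^ r\<close>, hence at most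
    \<open>Q ^ (2 * r)\<close>.\<close>
  have sep: "real P * (\<epsilon> / 2) < 1 / real (\<Prod>i<r. q i)"
  proof -
    have "(\<Prod>i<r. q i) \<le> (\<Prod>i<r. Q)"
      by (intro prod_mono) (auto intro: qQ)
    also have "\<dots> = Q ^ r" by simp
    also have "\<dots> \<le> Q ^ (2 * r)"
      using \<open>1 \<le> Q\<close> by (intro power_increasing) auto
    finally have "real (\<Prod>i<r. q i) \<le> real Q ^ (2 * r)"
      by (simp only: of_nat_power[symmetric] of_nat_le_iff)
    moreover have "0 < (\<Prod>i<r. q i)" using q by (intro prod_pos) auto
    hence "0 < real (\<Prod>i<r. q i)" by (simp only: of_nat_0_less_iff)
    ultimately have "1 / real Q ^ (2 * r) \<le> 1 / real (\<Prod>i<r. q i)"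
      by (intro frac_le) auto
    thus ?thesis using reps by (simp add: P_def)
  qed
  have "\<epsilon> < 1"
  proof -
    have "\<epsilon> \<le> real r * \<epsilon>" using assms(1) eps(1) by simp
    also have "\<dots> < 1 / real Q ^ (2 * r)" by (rule reps)
    also have "\<dots> \<le> 1" using \<open>1 \<le> Q\<close> by simp
    finally show ?thesis .
  qed
  obtain M where M: "\<And>\<xi>. norm (m \<xi>) \<le> M"
    using mult unfolding Lp_multiplier_def bounded_iff by auto
  have proj: "freq_projection m \<epsilon> \<theta> M" if "0 \<le> \<theta> \<and> \<theta> \<le> 1" for \<theta>
  proof
    show "m \<xi> = 0" if "1 / 2 < \<bar>\<xi>\<bar>" for \<xi>
      using that assms(3)[rule_format, of \<xi>] by (auto simp: abs_if split: if_splits)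
  qed (use mult M eps \<open>\<epsilon> < 1\<close> that in \<open>auto simp: Lp_multiplier_def\<close>)

  define g where "g \<theta> n = freq_piece (real P) m \<epsilon> \<theta> f n" for \<theta> n
  define R where "R i = reduced_fracs (q i)" for i
  \<comment> \<open>Expanding the product over \<open>i\<close> means choosing a pair of fractions
    for every \<open>i\<close>: one for the piece, one for the conjugated piece.\<close>
  define \<Gamma> where "\<Gamma> = (\<Pi>\<^sub>E i\<in>{..<r}. R i \<times> R i)"
  define T where "T \<gamma> n = (\<Prod>i<r. g (fst (\<gamma> i)) n * cnj (g (snd (\<gamma> i)) n))" for \<gamma> :: "nat \<Rightarrow> real \<times> real" and n
  define diag where "diag \<gamma> \<longleftrightarrow> (\<forall>i<r. fst (\<gamma> i) = snd (\<gamma> i))" for \<gamma> :: "nat \<Rightarrow> real \<times> real"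
  have finR: "finite (R i)" for i
    by (simp add: R_def finite_reduced_fracs)

  have T: "integrable int_counting (T \<gamma>)" "\<not> diag \<gamma> \<Longrightarrow> (\<integral>n. T \<gamma> n \<partial>int_counting) = 0"
    if \<gamma>: "\<gamma> \<in> \<Gamma>" for \<gamma>
  proof -
    \<comment> \<open>The Boolean tells a factor from its conjugate. Thus \<open>T \<gamma>\<close>
      is a single product over 2r indices, as many as the exponent.\<close>
    let ?J = "{..<r} \<times> (UNIV :: bool set)"
    define \<theta> where "\<theta> j = (if snd j then fst (\<gamma> (fst j)) else snd (\<gamma> (fst j)))" for j :: "nat \<times> bool"
    have card: "card ?J = P" by (simp add: P_def card_cartesian_product)
    have \<gamma>R: "fst (\<gamma> i) \<in> R i" "snd (\<gamma> i) \<in> R i" if "i < r" for i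
      using \<gamma> that by (auto simp: \<Gamma>_def PiE_def Pi_def mem_Times_iff)
    have J: "finite ?J" "?J \<noteq> {}" using assms(1) by (auto simp: lessThan_empty_iff)
    have "freq_projection m \<epsilon> (\<theta> j) M" if "j \<in> ?J" for j
      using that \<gamma>R by (intro proj reduced_fracs_bounds[of _ "q (fst j)"]) (auto simp: \<theta>_def R_def)
    note prod = signed_freq_piece_prod[OF J, of m \<epsilon> \<theta> M f snd, unfolded card, OF this mult f]
    have prod_eq: "(\<Prod>j\<in>?J. signed (snd j) (freq_piece (real P) m \<epsilon> (\<theta> j) f n)) = T \<gamma> n" for n
      unfolding T_def
      by (simp add: prod.cartesian_product' UNIV_bool signed_def \<theta>_def g_def mult.commute)
    show "integrable int_counting (T \<gamma>)"
      using prod(1) unfolding prod_eq .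
    assume "\<not> diag \<gamma>"
    hence ne: "\<exists>i\<in>{..<r}. fst (\<gamma> i) \<noteq> snd (\<gamma> i)" by (auto simp: diag_def)
    have sum_eq: "(\<Sum>j\<in>?J. if snd j then \<theta> j else - \<theta> j) = (\<Sum>i<r. fst (\<gamma> i) - snd (\<gamma> i))"
      by (simp add: sum.cartesian_product' UNIV_bool \<theta>_def)
    have "real P * (\<epsilon> / 2) < \<bar>(\<Sum>j\<in>?J. if snd j then \<theta> j else - \<theta> j) - of_int l\<bar>" for l :: int
      unfolding sum_eq
      using reduced_fracs_separation[of "{..<r}" q "\<lambda>i. fst (\<gamma> i)" "\<lambda>i. snd (\<gamma> i)" l] q cop \<gamma>R ne sep
      unfolding R_def by force
    from prod(2)[OF _ this] show "(\<integral>n. T \<gamma> n \<partial>int_counting) = 0"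
      unfolding prod_eq .
  qed

  define A where "A n = (\<Prod>i<r. (norm (freq_sum (real P) m \<epsilon> (q i) f n))\<^sup>2)" for n
  define B where "B n = (\<Prod>i<r. (freq_square (real P) m \<epsilon> (q i) f n)\<^sup>2)" for n
  have A: "complex_of_real (A n) = (\<Sum>\<gamma>\<in>\<Gamma>. T \<gamma> n)" for n
  proof -
    have "complex_of_real (A n) = (\<Prod>i<r. \<Sum>p\<in>R i \<times> R i. g (fst p) n * cnj (g (snd p) n))"
      unfolding A_def of_real_prod freq_sum_def g_def[symmetric] R_def[symmetric]
      by (intro prod.cong refl norm_sum_squared finR)
    also have "\<dots> = (\<Sum>\<gamma>\<in>\<Gamma>. T \<gamma> n)"
      unfolding \<Gamma>_def T_def by (intro prod_sum_PiE) (auto intro: finR)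
    finally show ?thesis .
  qed
  have B: "complex_of_real (B n) = (\<Sum>\<gamma>\<in>\<Gamma>. if diag \<gamma> then T \<gamma> n else 0)" for n
  proof -
    have "complex_of_real (B n)
        = (\<Prod>i<r. \<Sum>p\<in>R i \<times> R i. if fst p = snd p then g (fst p) n * cnj (g (snd p) n) else 0)"
      unfolding B_def of_real_prod freq_square_def g_def[symmetric] R_def[symmetric]
      by (intro prod.cong refl) (subst real_sqrt_pow2, auto intro: sum_nonneg sum_norm_squared finR simp del: of_real_sum)
    also have "\<dots> = (\<Sum>\<gamma>\<in>\<Gamma>. \<Prod>i<r. if fst (\<gamma> i) = snd (\<gamma> i)
        then g (fst (\<gamma> i)) n * cnj (g (snd (\<gamma> i)) n) else 0)"
      unfolding \<Gamma>_def by (intro prod_sum_PiE) (auto intro: finR)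
    also have "\<dots> = (\<Sum>\<gamma>\<in>\<Gamma>. if diag \<gamma> then T \<gamma> n else 0)"
    proof (rule sum.cong)
      fix \<gamma> assume "\<gamma> \<in> \<Gamma>"
      show "(\<Prod>i<r. if fst (\<gamma> i) = snd (\<gamma> i) then g (fst (\<gamma> i)) n * cnj (g (snd (\<gamma> i)) n) else 0)
          = (if diag \<gamma> then T \<gamma> n else 0)"
        by (auto simp: diag_def T_def intro!: prod.cong)
    qed simp
    finally show ?thesis .
  qed
  \<comment> \<open>Integrability has to be shown for \<open>A\<close> and \<open>B\<close>
    separately: without it \<open>Lp_norm\<close> is infinite, and equality of the integrals would
    say nothing about the norms.\<close>
  have "integrable int_counting (\<lambda>n. complex_of_real (A n))"
    unfolding A by (intro Bochner_Integration.integrable_sum T)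
  hence intA: "integrable int_counting A"
    by (simp add: complex_of_real_integrable_eq)
  have if_int: "integrable int_counting (\<lambda>n. if diag \<gamma> then T \<gamma> n else 0)" if "\<gamma> \<in> \<Gamma>" for \<gamma>
    using T(1)[OF that] by (cases "diag \<gamma>") auto
  have "integrable int_counting (\<lambda>n. complex_of_real (B n))"
    unfolding B by (intro Bochner_Integration.integrable_sum if_int)
  hence intB: "integrable int_counting B"
    by (simp add: complex_of_real_integrable_eq)
  have "complex_of_real (\<integral>n. A n \<partial>int_counting) = (\<integral>n. (\<Sum>\<gamma>\<in>\<Gamma>. T \<gamma> n) \<partial>int_counting)"
    unfolding A[symmetric] by simp
  also have "\<dots> = (\<Sum>\<gamma>\<in>\<Gamma>. \<integral>n. T \<gamma> n \<partial>int_counting)"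
    by (intro Bochner_Integration.integral_sum T)
  also have "\<dots> = (\<Sum>\<gamma>\<in>\<Gamma>. \<integral>n. (if diag \<gamma> then T \<gamma> n else 0) \<partial>int_counting)"
  proof (rule sum.cong)
    fix \<gamma> assume "\<gamma> \<in> \<Gamma>"
    thus "(\<integral>n. T \<gamma> n \<partial>int_counting) = (\<integral>n. (if diag \<gamma> then T \<gamma> n else 0) \<partial>int_counting)"
      using T(2) by (cases "diag \<gamma>") auto
  qed simp
  also have "\<dots> = (\<integral>n. (\<Sum>\<gamma>\<in>\<Gamma>. if diag \<gamma> then T \<gamma> n else 0) \<partial>int_counting)"
    by (intro Bochner_Integration.integral_sum[symmetric] if_int)
  also have "\<dots> = complex_of_real (\<integral>n. B n \<partial>int_counting)"
    unfolding B[symmetric] by simp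
  finally have AB: "(\<integral>n. A n \<partial>int_counting) = (\<integral>n. B n \<partial>int_counting)"
    by (simp only: of_real_eq_iff)
  have powA: "norm (\<Prod>i<r. norm (freq_sum (real P) m \<epsilon> (q i) f n) powr (1 / real r)) ^ P = A n" for n
    unfolding P_def A_def using prod_powr_inverse_power[OF assms(1)] by simp
  have powB: "norm (\<Prod>i<r. freq_square (real P) m \<epsilon> (q i) f n powr (1 / real r)) ^ P = B n" for n
    unfolding P_def B_def by (rule prod_powr_inverse_power[OF assms(1)])
      (simp add: freq_square_def sum_nonneg)
  show "lp_norm (2 * real r)
      (\<lambda>n. \<Prod>i<r. norm (freq_sum (2 * real r) m \<epsilon> (q i) f n) powr (1 / real r))
    \<le> ennreal 1 * lp_norm (2 * real r)
      (\<lambda>n. \<Prod>i<r. freq_square (2 * real r) m \<epsilon> (q i) f n powr (1 / real r))"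
    unfolding P(2) Lp_norm_power[OF P(1)] powA powB using intA intB by (simp add: AB)
qed

end
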